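(* Suppose $C\subset\mathbb{D}^n$ is a split SLAG cone which is regular and connected outside the origin; that is, $C$ is a closed subset of $\mathbb{D}^n$ with $tC=C$ for all $t>0$, and $C-\{0\}$ is a connected split SLAG submanifold of $\mathbb{D}^n-\{0\}$. Then $C$ is a split special Lagrangian $n$-plane (a real $n$-dimensional linear subspace of $\mathbb{D}^n$ which, suitably oriented, is a split SLAG submanifold of $\mathbb{D}^n$).
   Context: $\mathbb{D}$ denotes the double numbers: the commutative real algebra generated by $1$ and $\tau$ with $\tau^2=1$. For $z=x+\tau y\in\mathbb{D}$ ($x,y\in\mathbb{R}$) write $\mathrm{Re}\,z=x$, $\mathrm{Im}\,z=y$. $\mathbb{D}^n=\mathbb{R}^n\oplus\tau\mathbb{R}^n$ has coordinates $z_j=x_j+\tau y_j$, the real inner product of signature $(n,n)$ with quadratic form $\langle z,z\rangle=\sum_j(x_j^2-y_j^2)$, the symplectic form $\omega=\sum_j dx_j\wedge dy_j$, and the $\mathbb{D}$-valued $n$-form $dz=dz_1\wedge\cdots\wedge dz_n$, $dz_j=dx_j+\tau dy_j$. A real $n$-plane $P\subset\mathbb{D}^n$ is space-like if $\langle\cdot,\cdot\rangle|_P$ is positive definite; such a plane projects isomorphically to $\mathbb{R}^n$, and an oriented space-like $n$-plane is positive if this projection preserves the standard orientation. An oriented $C^1$ submanifold is positive space-like if all its tangent planes are. A split SLAG submanifold of an open set $U\subset\mathbb{D}^n$ is a closed oriented $n$-dimensional $C^1$ submanifold $M$ of $U$ which is positive space-like, Lagrangian ($\omega|_M=0$), and satisfies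 $(\mathrm{Im}\,dz)|_M=0$.
   Formalization: The formal theorem assumes n ≥ 2 and that C−{0} is nonempty: for n = 1 the claim fails, since C is then always a half-line such as {x ≥ 0}, which is not a linear subspace, and C = {0} is excluded by taking connected to mean nonempty. *)

theory Defs
  imports "HOL-Analysis.Analysis"
begin

section \<open>Double numbers\<close>

datatype double = Double (dRe: real) (dIm: real)

instantiation double :: "{comm_ring_1, real_algebra_1}"
begin

definition "0 = Double 0 0"
definition "1 = Double 1 0"
definition "z + w = Double (dRe z + dRe w) (dIm z + dIm w)"
definition "- z = Double (- dRe z) (- dIm z)"
definition "z - w = Double (dRe z - dRe w) (dIm z - dIm w)"
definition "z * w = Double (dRe z * dRe w + dIm z * dIm w) (dRe z * dIm w + dIm z * dRe w)"
definition "scaleR r z = Double (r * dRe z) (r * dIm z)"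

instance
  by standard
    (simp_all add: zero_double_def one_double_def plus_double_def uminus_double_def
      minus_double_def times_double_def scaleR_double_def algebra_simps double.expand)

end

definition tau :: double where
  "tau = Double 0 1"

lemma tau_squared: "tau * tau = 1"
  by (simp add: tau_def times_double_def one_double_def)

lemma double_eq: "Double x y = of_real x + tau * of_real y"
  by (simp add: tau_def of_real_def times_double_def plus_double_def
      scaleR_double_def one_double_def)


section \<open>The space of n-tuples of double numbers\<close>

text \<open>The pair \<open>(x, y)\<close> stands for \<open>x + \<tau> y\<close>. The (Euclidean) inner product
  of the type class serves only for the topology; the geometry uses \<open>split_inner\<close> below.\<close>

type_synonym 'n dspace = "(real^'n) \<times> (real^'n)"

definition split_inner :: "'n::finite dspace \<Rightarrow> 'n dspace \<Rightarrow> real" where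
  "split_inner v w = (\<Sum>j\<in>UNIV. fst v $ j * fst w $ j - snd v $ j * snd w $ j)"

definition omega :: "'n::finite dspace \<Rightarrow> 'n dspace \<Rightarrow> real" where
  "omega v w = (\<Sum>j\<in>UNIV. fst v $ j * snd w $ j - fst w $ j * snd v $ j)"

definition dz_coord :: "'n::finite \<Rightarrow> 'n dspace \<Rightarrow> double" where
  "dz_coord j v = Double (fst v $ j) (snd v $ j)"

text \<open>The wedge product of the one-forms \<open>dz_coord j\<close>, evaluated on a family of vectors that is
  indexed by the same type as the coordinates; hence no ordering of the indices is needed.\<close>

definition dz :: "('n::finite \<Rightarrow> 'n dspace) \<Rightarrow> double" where
  "dz v = det (\<chi> i j. dz_coord i (v j))"


section \<open>Oriented planes\<close>

definition frame_of :: "'n::finite dspace set \<Rightarrow> ('n \<Rightarrow> 'n dspace) \<Rightarrow> bool" where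
  "frame_of P b \<longleftrightarrow> inj b \<and> independent (range b) \<and> span (range b) = P"

definition same_orientation :: "('n::finite \<Rightarrow> 'n dspace) \<Rightarrow> ('n \<Rightarrow> 'n dspace) \<Rightarrow> bool" where
  "same_orientation b c \<longleftrightarrow>
     (\<exists>A :: real^'n^'n. det A > 0 \<and> (\<forall>j. c j = (\<Sum>i\<in>UNIV. A $ i $ j *\<^sub>R b i)))"

text \<open>An orientation of an n-plane is the class of its positively oriented frames.\<close>

definition orientation_of :: "'n::finite dspace set \<Rightarrow> ('n \<Rightarrow> 'n dspace) set \<Rightarrow> bool" where
  "orientation_of P Or \<longleftrightarrow> (\<exists>b. frame_of P b \<and> Or = {c. same_orientation b c})"

definition spacelike :: "'n::finite dspace set \<Rightarrow> bool" where
  "spacelike P \<longleftrightarrow> (\<forall>v\<in>P. v \<noteq> 0 \<longrightarrow> split_inner v v > 0)"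

definition positive_plane :: "'n::finite dspace set \<Rightarrow> ('n \<Rightarrow> 'n dspace) set \<Rightarrow> bool" where
  "positive_plane P Or \<longleftrightarrow>
     spacelike P \<and> (\<forall>b\<in>Or. det (\<chi> i j. fst (b j) $ i) > 0)"


section \<open>Oriented submanifolds\<close>

definition tangent_space :: "'a::real_normed_vector set \<Rightarrow> 'a \<Rightarrow> 'a set" where
  "tangent_space M p =
     {v. \<exists>\<gamma> e. e > 0 \<and> \<gamma> 0 = p \<and> (\<forall>t::real. \<bar>t\<bar> < e \<longrightarrow> \<gamma> t \<in> M) \<and>
         (\<gamma> has_vector_derivative v) (at 0)}"

definition local_C1_parametrization ::
  "'n::finite dspace set \<Rightarrow> (real^'n) set \<Rightarrow> (real^'n \<Rightarrow> 'n dspace) \<Rightarrow>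
   (real^'n \<Rightarrow> (real^'n) \<Rightarrow>\<^sub>L 'n dspace) \<Rightarrow> bool" where
  "local_C1_parametrization M W f f' \<longleftrightarrow>
     open W \<and> openin (top_of_set M) (f ` W) \<and> (\<exists>g. homeomorphism W (f ` W) f g) \<and>
     (\<forall>u\<in>W. (f has_derivative blinfun_apply (f' u)) (at u)) \<and> continuous_on W f' \<and>
     (\<forall>u\<in>W. inj (blinfun_apply (f' u)))"

text \<open>An embedded \<open>C\<^sup>1\<close> submanifold of dimension n, together with a continuous choice \<open>Or p\<close> of
  orientations of its tangent spaces: continuity means that there are local parametrizations
  preserving the orientation.\<close>

definition oriented_C1_submanifold ::
  "'n::finite dspace set \<Rightarrow> ('n dspace \<Rightarrow> ('n \<Rightarrow> 'n dspace) set) \<Rightarrow> bool" where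
  "oriented_C1_submanifold M Or \<longleftrightarrow>
     (\<forall>p\<in>M. orientation_of (tangent_space M p) (Or p)) \<and>
     (\<forall>p\<in>M. \<exists>W f f'. local_C1_parametrization M W f f' \<and> p \<in> f ` W \<and>
        (\<forall>u\<in>W. (\<lambda>j. blinfun_apply (f' u) (axis j 1)) \<in> Or (f u)))"


section \<open>Split special Lagrangian submanifolds\<close>

definition split_SLAG_submanifold ::
  "'n::finite dspace set \<Rightarrow> 'n dspace set \<Rightarrow> ('n dspace \<Rightarrow> ('n \<Rightarrow> 'n dspace) set) \<Rightarrow> bool" where
  "split_SLAG_submanifold U M Or \<longleftrightarrow>
     open U \<and> closedin (top_of_set U) M \<and> oriented_C1_submanifold M Or \<and>
     (\<forall>p\<in>M. positive_plane (tangent_space M p) (Or p)) \<and>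
     (\<forall>p\<in>M. \<forall>v\<in>tangent_space M p. \<forall>w\<in>tangent_space M p. omega v w = 0) \<and>
     (\<forall>p\<in>M. \<forall>v. range v \<subseteq> tangent_space M p \<longrightarrow> dIm (dz v) = 0)"

definition split_SLAG_plane :: "'n::finite dspace set \<Rightarrow> bool" where
  "split_SLAG_plane P \<longleftrightarrow>
     subspace P \<and> dim P = CARD('n) \<and> (\<exists>Or. split_SLAG_submanifold UNIV P Or)"

end

(* In the null coordinates u = x + y, v = x - y, a tangent plane of a split SLAG submanifold is the
   graph v = A u of a symmetric positive definite matrix A with det A = 1. Hence the cone is locally
   the graph of the gradient of a function phi, homogeneous of degree 2, with det D^2 phi = 1. Fix e.
   As log det is concave, the second derivative phi_ee is a (weak) subsolution of the linearized
   operator trace (A^-1 D^2 .). It is homogeneous of degree 0, so it attains its maximum on the cone,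
   and by the strong maximum principle (with Hopf's barrier) and connectedness it is constant.
   Polarizing over e, the matrix A is constant, so the cone lies in the plane v = A u and is open and
   closed in that plane without the origin. Working on the cone itself avoids the question whether it
   is globally a graph, which is not clear a priori when n = 2. *)

theory Submission
  imports Defs
begin

text \<open>The submanifold is only of class C^1, so phi is only C^2 and phi_ee merely continuous:
  it cannot be inserted into a second-order operator. What replaces this is an exact inequality at
  each fixed step h. For positive definite A and B of determinant 1 the trace of A^-1 B is at least
  n, so the second difference of the Hessian in direction e has nonnegative trace against A(x)^-1,
  by n + n - 2n = 0. The difference quotient of phi is itself C^2, so the elementary second
  derivative test applies to it at a maximum. As h tends to 0 the quotients converge to phi_ee
  uniformly on compact sets, and a strict gap between the value at a centre and those on a sphere
  survives the approximation; this is why the barrier is arranged to be strict on a whole sphere.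
  All matrix inequalities become scalar ones through a congruence that turns A into the identity and
  a second symmetric matrix into a diagonal one.\<close>

section \<open>Positive definite matrices\<close>

definition posdef :: "real^'n^'n \<Rightarrow> bool" where
  "posdef A \<longleftrightarrow> transpose A = A \<and> (\<forall>x. x \<noteq> 0 \<longrightarrow> x \<bullet> (A *v x) > 0)"

lemma inner_symmetric_matrix:
  fixes A :: "real^'n^'n"
  assumes "transpose A = A"
  shows "x \<bullet> (A *v y) = y \<bullet> (A *v x)"
  by (metis assms dot_lmul_matrix inner_commute transpose_matrix_vector)

lemma linear_coefficient_zero:
  fixes a b :: real
  assumes "\<And>t. 2 * t * a + t\<^sup>2 * b \<le> 0"
  shows "a = 0"
proof (rule ccontr)
  assume "a \<noteq> 0"
  \<comment> \<open>With \<open>c\<close> above the absolute value of \<open>b\<close>, the choice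
    \<open>t = a / c\<close> gives a linear term of twice \<open>a\<^sup>2 / c\<close> and a
    quadratic term of at least its negative.\<close>
  define c where "c = \<bar>b\<bar> + 1"
  have "c > 0" "b \<ge> - c" unfolding c_def by auto
  have "2 * (a / c) * a + (a / c)\<^sup>2 * b \<le> 0" by (rule assms)
  moreover have "(a / c)\<^sup>2 * b \<ge> (a / c)\<^sup>2 * (- c)"
    using \<open>b \<ge> - c\<close> by (intro mult_left_mono) auto
  moreover have "(a / c)\<^sup>2 * (- c) = - (a\<^sup>2 / c)" "2 * (a / c) * a = 2 * (a\<^sup>2 / c)"
    using \<open>c > 0\<close> by (auto simp: power2_eq_square field_simps)
  moreover have "a\<^sup>2 / c > 0" using \<open>a \<noteq> 0\<close> \<open>c > 0\<close> by simp
  ultimately show False by linarith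
qed

text \<open>The constant is the minimum of the form on the unit sphere, carried to all vectors by
  homogeneity.\<close>

lemma posdef_lower_bound:
  fixes A :: "real^'n^'n"
  assumes "posdef A"
  obtains l where "l > 0" "\<And>x. x \<bullet> (A *v x) \<ge> l * (norm x)\<^sup>2"
proof -
  have "sphere (0::real^'n) 1 \<noteq> {}"
    by simp
  moreover have "continuous_on (sphere 0 1) (\<lambda>x. x \<bullet> (A *v x))"
    by (intro continuous_intros linear_continuous_on) (simp add: linear_linear)
  ultimately obtain z where z: "z \<in> sphere 0 1" "\<And>x. x \<in> sphere 0 1 \<Longrightarrow> z \<bullet> (A *v z) \<le> x \<bullet> (A *v x)"
    using continuous_attains_inf[OF compact_sphere] by blast
  have pos: "z \<bullet> (A *v z) > 0" using assms z(1) unfolding posdef_def by (metis mem_sphere_0 norm_zero zero_neq_one)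
  have "x \<bullet> (A *v x) \<ge> z \<bullet> (A *v z) * (norm x)\<^sup>2" for x
  proof (cases "x = 0")
    case False
    have "z \<bullet> (A *v z) \<le> (x /\<^sub>R norm x) \<bullet> (A *v (x /\<^sub>R norm x))"
      using False by (intro z(2)) auto
    also have "\<dots> = (x \<bullet> (A *v x)) / (norm x)\<^sup>2"
      by (simp add: matrix_vector_mult_scaleR power2_eq_square divide_inverse)
    finally show ?thesis using False by (simp add: field_simps)
  qed simp
  with pos that show ?thesis by blast
qed

text \<open>Rayleigh's principle: \<open>x\<close> maximizes the form of \<open>B\<close> on the
  \<open>A\<close>-unit sphere of \<open>W\<close>, and \<open>m\<close> is the maximum. The first
  variation vanishes only in directions of \<open>W\<close>, so the eigenvalue equation is tested
  against \<open>y \<in> W\<close> alone.\<close>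

lemma generalized_eigenvector:
  fixes A B :: "real^'n^'n"
  assumes A: "posdef A" and B: "transpose B = B" and W: "subspace W" "W \<noteq> {0}"
  obtains x m where "x \<in> W" "x \<bullet> (A *v x) = 1" "\<And>y. y \<in> W \<Longrightarrow> y \<bullet> (B *v x) = m * (y \<bullet> (A *v x))"
proof -
  obtain w where w: "w \<in> W" "w \<noteq> 0" using W subspace_0 by blast
  have tA: "transpose A = A" using A by (simp add: posdef_def)
  have contA: "continuous_on S (\<lambda>x. x \<bullet> (A *v x))" and contB: "continuous_on S (\<lambda>x. x \<bullet> (B *v x))" for S
    by (intro continuous_intros linear_continuous_on; simp add: linear_linear)+
  define K where "K = W \<inter> {x. x \<bullet> (A *v x) = 1}"
  obtain l where l: "l > 0" "\<And>x. x \<bullet> (A *v x) \<ge> l * (norm x)\<^sup>2"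
    using posdef_lower_bound[OF A] by blast
  have "compact K"
  proof (rule bounded_closed_imp_seq_compact[unfolded compact_eq_seq_compact_metric[symmetric]])
    have "norm x \<le> sqrt (1 / l)" if "x \<in> K" for x
    proof -
      have "(norm x)\<^sup>2 \<le> 1 / l" using l(2)[of x] l(1) that by (simp add: K_def field_simps)
      then show ?thesis using real_le_rsqrt by blast
    qed
    then show "bounded K" by (auto simp: bounded_iff)
    show "closed K" unfolding K_def
      using closed_subspace[OF W(1)] continuous_closed_preimage[OF contA closed_UNIV closed_singleton[of 1]]
      by (auto intro!: closed_Int simp: vimage_def)
  qed
  have wA: "w \<bullet> (A *v w) > 0" using A w by (simp add: posdef_def)
  have scale: "(c *\<^sub>R y) \<bullet> (M *v (c *\<^sub>R y)) = c\<^sup>2 * (y \<bullet> (M *v y))" for c y and M :: "real^'n^'n"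
    by (simp add: matrix_vector_mult_scaleR power2_eq_square)
  have "(1 / sqrt (w \<bullet> (A *v w))) *\<^sub>R w \<in> K"
    unfolding K_def using wA w W(1) by (auto simp only: scale Int_iff mem_Collect_eq subspace_scale) 
      (simp add: power_divide)
  then have "K \<noteq> {}" by blast
  then obtain x where x: "x \<in> K" "\<And>y. y \<in> K \<Longrightarrow> y \<bullet> (B *v y) \<le> x \<bullet> (B *v x)"
    using continuous_attains_sup[OF \<open>compact K\<close> _ contB] by blast
  define m where "m = x \<bullet> (B *v x)"
  \<comment> \<open>Homogeneity turns maximality on \<open>K\<close> into an inequality on all of
    \<open>W\<close>. Along the line \<open>x + t *\<^sub>R y\<close> it is a quadratic in
    \<open>t\<close> that vanishes at 0, so its linear coefficient must be zero.\<close>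
  have le: "y \<bullet> (B *v y) - m * (y \<bullet> (A *v y)) \<le> 0" if "y \<in> W" for y
  proof (cases "y = 0")
    case False
    then have yA: "y \<bullet> (A *v y) > 0" using A by (simp add: posdef_def)
    have "(1 / sqrt (y \<bullet> (A *v y))) *\<^sub>R y \<in> K"
      unfolding K_def using yA that W(1) by (auto simp only: scale Int_iff mem_Collect_eq subspace_scale) 
        (simp add: power_divide)
    from x(2)[OF this] have "(y \<bullet> (B *v y)) / (y \<bullet> (A *v y)) \<le> m"
      using yA unfolding scale m_def by (simp add: power_divide)
    then show ?thesis using yA by (simp add: field_simps)
  qed simp
  have xW: "x \<in> W" and xA: "x \<bullet> (A *v x) = 1" using x(1) by (auto simp: K_def)
  have "y \<bullet> (B *v x) = m * (y \<bullet> (A *v x))" if "y \<in> W" for y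
  proof -
    have "2 * t * (y \<bullet> (B *v x) - m * (y \<bullet> (A *v x))) + t\<^sup>2 * (y \<bullet> (B *v y) - m * (y \<bullet> (A *v y))) \<le> 0" for t
    proof -
      have "x + t *\<^sub>R y \<in> W" using W(1) xW that by (simp add: subspace_add subspace_scale)
      from le[OF this] show ?thesis
        using inner_symmetric_matrix[OF tA, of x y] inner_symmetric_matrix[OF B, of x y] xA
        by (simp add: matrix_vector_right_distrib matrix_vector_mult_scaleR inner_add_left inner_add_right
            m_def power2_eq_square algebra_simps)
    qed
    from linear_coefficient_zero[OF this] show ?thesis by simp
  qed
  with xW xA that show ?thesis by blast
qed

text \<open>Induction on the index set, one eigenvector at a time: the next one is taken from the
  \<open>A\<close>-orthogonal complement of those already found, which is nonzero by dimension as
  long as an index remains.\<close>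

lemma simultaneous_eigenbasis:
  fixes A B :: "real^'n^'n"
  assumes A: "posdef A" and B: "transpose B = B"
  shows "\<exists>r :: 'n \<Rightarrow> real^'n. \<exists>m. \<forall>i\<in>I. (\<forall>j\<in>I. r i \<bullet> (A *v r j) = (if i = j then 1 else 0)) \<and>
    B *v r i = m i *\<^sub>R (A *v r i)"
proof (induction I rule: finite_induct[OF finite])
  case 1
  then show ?case by simp
next
  case (2 k I)
  have tA: "transpose A = A" using A by (simp add: posdef_def)
  from 2 obtain r :: "'n \<Rightarrow> real^'n" and m where
    r: "\<And>i j. i \<in> I \<Longrightarrow> j \<in> I \<Longrightarrow> r i \<bullet> (A *v r j) = (if i = j then 1 else 0)"
    and m: "\<And>i. i \<in> I \<Longrightarrow> B *v r i = m i *\<^sub>R (A *v r i)" by metis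
  define W where "W = {x. \<forall>i\<in>I. x \<bullet> (A *v r i) = 0}"
  have "subspace W" by (auto simp: W_def subspace_def inner_add_left)
  have "dim ((\<lambda>i. A *v r i) ` I) \<le> card I"
    by (meson card_image_le dim_le_card' finite finite_imageI le_trans)
  also have "\<dots> < DIM(real^'n)"
    using 2(2) psubset_card_mono[of UNIV I] by auto
  finally obtain x where x: "x \<noteq> 0" "\<And>y. y \<in> span ((\<lambda>i. A *v r i) ` I) \<Longrightarrow> orthogonal x y"
    using orthogonal_to_subspace_exists by blast
  then have "x \<in> W" by (auto simp: W_def orthogonal_def span_base)
  with x(1) have "W \<noteq> {0}" by blast
  then obtain e c where e: "e \<in> W" "e \<bullet> (A *v e) = 1"
    "\<And>y. y \<in> W \<Longrightarrow> y \<bullet> (B *v e) = c * (y \<bullet> (A *v e))"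
    using generalized_eigenvector[OF A B \<open>subspace W\<close>] by blast
  have eA: "e \<bullet> (A *v r i) = 0" "r i \<bullet> (A *v e) = 0" if "i \<in> I" for i
    using e(1) that inner_symmetric_matrix[OF tA, of e "r i"] by (auto simp: W_def)
  have "y \<bullet> (B *v e - c *\<^sub>R (A *v e)) = 0" for y
  proof -
    \<comment> \<open>\<open>p\<close> is the \<open>A\<close>-orthogonal projection of
      \<open>y\<close> onto the span of the earlier vectors. The equation for \<open>e\<close> holds
      against \<open>y - p\<close> by the choice of \<open>e\<close>. Against \<open>p\<close> both
      sides vanish, because \<open>B *v r i\<close> is a multiple of \<open>A *v r i\<close>, to
      which \<open>e\<close> is orthogonal.\<close>
    define p where "p = (\<Sum>i\<in>I. (y \<bullet> (A *v r i)) *\<^sub>R r i)"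
    have "p \<bullet> (A *v r j) = y \<bullet> (A *v r j)" if "j \<in> I" for j
      using that by (simp add: p_def inner_sum_left r if_distrib[of "(*) _"] cong: if_cong)
    then have "y - p \<in> W" by (auto simp: W_def inner_diff_left)
    from e(3)[OF this] have "(y - p) \<bullet> (B *v e - c *\<^sub>R (A *v e)) = 0"
      by (simp add: inner_diff_right)
    moreover have "p \<bullet> (B *v e - c *\<^sub>R (A *v e)) = 0"
    proof -
      have "r i \<bullet> (B *v e) = 0" if "i \<in> I" for i
        using inner_symmetric_matrix[OF B, of "r i" e] m[OF that] eA[OF that] by simp
      then show ?thesis by (simp add: p_def inner_sum_left inner_diff_right eA)
    qed
    ultimately show ?thesis by (simp add: inner_diff_left)
  qed
  then have "B *v e = c *\<^sub>R (A *v e)"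
    by (metis inner_eq_zero_iff right_minus_eq)
  then have "\<forall>i\<in>insert k I. (\<forall>j\<in>insert k I. (r(k := e)) i \<bullet> (A *v (r(k := e)) j) = (if i = j then 1 else 0)) \<and>
    B *v (r(k := e)) i = (m(k := c)) i *\<^sub>R (A *v (r(k := e)) i)"
    using 2(2) e(2) eA r m by auto
  then show ?case by blast
qed

lemma simultaneous_diagonalization:
  fixes A B :: "real^'n^'n"
  assumes A: "posdef A" and B: "transpose B = B"
  obtains R :: "real^'n^'n" and m where
    "transpose R ** A ** R = mat 1"
    "transpose R ** B ** R = (\<chi> i j. if i = j then m i else 0)"
proof -
  obtain r :: "'n \<Rightarrow> real^'n" and m where
    r: "\<And>i j. r i \<bullet> (A *v r j) = (if i = j then 1 else 0)"
    and m: "\<And>i. B *v r i = m i *\<^sub>R (A *v r i)"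
    using simultaneous_eigenbasis[OF A B, of UNIV] by (metis UNIV_I)
  define R :: "real^'n^'n" where "R = (\<chi> i j. r j $ i)"
  have entry: "(transpose R ** M ** R) $ i $ j = r i \<bullet> (M *v r j)" for M :: "real^'n^'n" and i j
    unfolding matrix_mul_assoc[symmetric]
    by (simp add: matrix_matrix_mult_def transpose_def R_def inner_vec_def matrix_vector_mult_def)
  have "transpose R ** A ** R = mat 1"
    by (simp add: vec_eq_iff entry r mat_def)
  moreover have "transpose R ** B ** R = (\<chi> i j. if i = j then m i else 0)"
    by (simp add: vec_eq_iff entry r m if_distrib cong: if_cong)
  ultimately show ?thesis using that by blast
qed

section \<open>Inverse, trace and determinant under a diagonalizing congruence\<close>

lemma matrix_inv_eqI:
  fixes A B :: "real^'n^'n"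
  assumes "A ** B = mat 1"
  shows "matrix_inv A = B"
proof -
  have "B ** A = mat 1" using assms matrix_left_right_inverse by blast
  then have "A ** matrix_inv A = mat 1"
    unfolding matrix_inv_def using assms by (metis (mono_tags, lifting) someI_ex)
  then have "B ** A ** matrix_inv A = B" by (simp flip: matrix_mul_assoc)
  with \<open>B ** A = mat 1\<close> show ?thesis by simp
qed

lemma matrix_inv_mult_left:
  fixes A :: "real^'n^'n"
  assumes "invertible A"
  shows "matrix_inv A ** A = mat 1"
  using assms matrix_inv_eqI unfolding invertible_def by metis

lemma matrix_inv_congruence:
  fixes A R :: "real^'n^'n"
  assumes "transpose R ** A ** R = mat 1"
  shows "matrix_inv A = R ** transpose R"
proof -
  have "R ** (transpose R ** A) = mat 1"
    using assms matrix_left_right_inverse by blast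
  then have "(R ** transpose R) ** A = mat 1" by (simp add: matrix_mul_assoc)
  then have "A ** (R ** transpose R) = mat 1"
    using matrix_left_right_inverse by blast
  then show ?thesis by (rule matrix_inv_eqI)
qed

text \<open>If \<open>R\<close> brings \<open>A\<close> to the identity, the inverse is
  \<open>R ** transpose R\<close>, whose quadratic form is the squared norm of
  \<open>transpose R *v x\<close>.\<close>

lemma posdef_matrix_inv:
  fixes A :: "real^'n^'n"
  assumes "posdef A"
  shows "posdef (matrix_inv A)"
proof -
  have "transpose A = A" using assms by (simp add: posdef_def)
  obtain R :: "real^'n^'n" and m where R: "transpose R ** A ** R = mat 1"
    using simultaneous_diagonalization[OF assms \<open>transpose A = A\<close>] by blast
  have "det (transpose R ** A ** R) = 1" by (simp add: R)
  then have "invertible (transpose R)" by (auto simp: det_mul invertible_det_nz)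
  then have inj: "transpose R *v x \<noteq> 0" if "x \<noteq> 0" for x
    using that by (metis invertible_def matrix_left_invertible_ker)
  have "x \<bullet> (R *v (transpose R *v x)) = (transpose R *v x) \<bullet> (transpose R *v x)" for x
    by (metis dot_lmul_matrix transpose_matrix_vector transpose_transpose)
  then show ?thesis
    using inj by (simp add: posdef_def matrix_inv_congruence[OF R] matrix_transpose_mul
        flip: matrix_vector_mul_assoc)
qed

lemma trace_inverse_mult:
  fixes A B R :: "real^'n^'n"
  assumes "transpose R ** A ** R = mat 1"
    and "transpose R ** B ** R = (\<chi> i j. if i = j then m i else 0)"
  shows "trace (matrix_inv A ** B) = sum m UNIV"
proof -
  have "trace (matrix_inv A ** B) = trace (R ** (transpose R ** B))"
    by (simp add: matrix_inv_congruence[OF assms(1)] matrix_mul_assoc)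
  also have "\<dots> = trace (transpose R ** B ** R)" by (rule trace_mul_sym)
  also have "\<dots> = sum m UNIV" by (simp add: assms(2) trace_def)
  finally show ?thesis .
qed

lemma congruence_diagonal_entry:
  fixes B R :: "real^'n^'n"
  assumes "transpose R ** B ** R = (\<chi> i j. if i = j then m i else 0)"
  shows "m i = column i R \<bullet> (B *v column i R)"
proof -
  have "m i = (transpose R ** B ** R) $ i $ i" by (simp add: assms)
  also have "\<dots> = column i R \<bullet> (B *v column i R)"
    unfolding matrix_mul_assoc[symmetric]
    by (simp add: matrix_matrix_mult_def transpose_def column_def inner_vec_def matrix_vector_mult_def)
  finally show ?thesis .
qed

text \<open>The algebraic half of the maximum principle, for \<open>N\<close> the Hessian at a
  maximum: after diagonalization the trace is a sum of values of the form of \<open>N\<close> on the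
  columns of \<open>R\<close>.\<close>

lemma trace_inverse_mult_nonpos:
  fixes A N :: "real^'n^'n"
  assumes "posdef A" "transpose N = N" "\<And>x. x \<bullet> (N *v x) \<le> 0"
  shows "trace (matrix_inv A ** N) \<le> 0"
proof -
  obtain R :: "real^'n^'n" and m where R: "transpose R ** A ** R = mat 1"
    "transpose R ** N ** R = (\<chi> i j. if i = j then m i else 0)"
    using simultaneous_diagonalization[OF assms(1,2)] by blast
  show ?thesis unfolding trace_inverse_mult[OF R]
    by (intro sum_nonpos) (simp add: congruence_diagonal_entry[OF R(2)] assms(3))
qed

lemma det_congruence_diagonal:
  fixes B R :: "real^'n^'n"
  assumes "transpose R ** B ** R = (\<chi> i j. if i = j then m i else 0)"
  shows "(det R)\<^sup>2 * det B = prod m UNIV"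
proof -
  have "prod m UNIV = det (transpose R ** B ** R)"
    unfolding assms by (subst det_diagonal) auto
  then show ?thesis by (simp add: det_mul power2_eq_square)
qed

lemma posdef_congruence_diagonal_pos:
  fixes B R :: "real^'n^'n"
  assumes "posdef B" "transpose R ** A ** R = mat 1"
    and "transpose R ** B ** R = (\<chi> i j. if i = j then m i else 0)"
  shows "m i > 0"
proof -
  have "column i R \<noteq> 0"
  proof
    assume "column i R = 0"
    then have "det R = 0" using det_zero_column by blast
    moreover have "det (transpose R ** A ** R) = 1" by (simp add: assms(2))
    ultimately show False by (simp add: det_mul)
  qed
  then show ?thesis using assms(1) unfolding posdef_def congruence_diagonal_entry[OF assms(3)] by blast
qed

lemma posdef_mat_1: "posdef (mat 1)"
  by (simp add: posdef_def)

lemma posdef_det_pos: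
  fixes B :: "real^'n^'n"
  assumes "posdef B"
  shows "det B > 0"
proof -
  obtain R :: "real^'n^'n" and m where R: "transpose R ** mat 1 ** R = mat 1"
    "transpose R ** B ** R = (\<chi> i j. if i = j then m i else 0)"
    using simultaneous_diagonalization[OF posdef_mat_1] assms unfolding posdef_def by blast
  have "prod m UNIV > 0"
    by (intro prod_pos) (simp add: posdef_congruence_diagonal_pos[OF assms R])
  then have "(det R)\<^sup>2 * det B > 0" by (simp add: det_congruence_diagonal[OF R(2)])
  then show ?thesis by (metis not_less zero_le_power2 mult_nonneg_nonpos)
qed

text \<open>Concavity of log det in its tangent form at \<open>A\<close>. The determinants force the
  product of the eigenvalues \<open>m i\<close> to be 1, so the logarithms sum to 0, and
  \<open>ln t \<le> t - 1\<close> is summed over them.\<close>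

lemma trace_inverse_mult_ge:
  fixes A B :: "real^'n^'n"
  assumes "posdef A" "posdef B" "det A = 1" "det B = 1"
  shows "trace (matrix_inv A ** B) \<ge> real CARD('n)"
proof -
  obtain R :: "real^'n^'n" and m where R: "transpose R ** A ** R = mat 1"
    "transpose R ** B ** R = (\<chi> i j. if i = j then m i else 0)"
    using simultaneous_diagonalization[OF assms(1), of B] assms(2) unfolding posdef_def by blast
  have pos: "m i > 0" for i by (rule posdef_congruence_diagonal_pos[OF assms(2) R])
  have "det (transpose R ** A ** R) = 1" by (simp add: R(1))
  then have "(det R)\<^sup>2 = 1" using assms(3) by (simp add: det_mul power2_eq_square)
  then have "prod m UNIV = 1" using det_congruence_diagonal[OF R(2)] assms(4) by simp
  then have "0 = (\<Sum>i\<in>UNIV. ln (m i))" using ln_prod[of UNIV m] less_imp_neq[OF pos] by auto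
  also have "\<dots> \<le> (\<Sum>i\<in>UNIV. m i - 1)"
    by (intro sum_mono) (simp add: ln_le_minus_one pos)
  finally show ?thesis by (simp add: trace_inverse_mult[OF R] sum_subtractf)
qed

section \<open>Continuity of determinant and inverse\<close>

lemma continuous_on_det:
  fixes A :: "'a::topological_space \<Rightarrow> real^'n^'n"
  assumes "continuous_on S A"
  shows "continuous_on S (\<lambda>x. det (A x))"
  unfolding det_def by (intro continuous_intros assms)

lemma continuous_on_matrix_inv:
  fixes A :: "'a::topological_space \<Rightarrow> real^'n^'n"
  assumes "continuous_on S A" "\<And>x. x \<in> S \<Longrightarrow> det (A x) \<noteq> 0"
  shows "continuous_on S (\<lambda>x. matrix_inv (A x))"
proof -
  \<comment> \<open>Cramer's rule for \<open>A x *v y = axis l 1\<close>: each entry of the inverse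
    is a quotient of determinants of matrices with continuous entries.\<close>
  define P where "P x = (\<chi> k l. det (\<chi> i j. if j = k then axis l 1 $ i else A x $ i $ j) / det (A x))" for x
  have "matrix_inv (A x) = P x" if "x \<in> S" for x
  proof -
    have "A x ** P x = mat 1"
    proof -
      have "A x *v (column l (P x)) = axis l 1" for l
        unfolding cramer[OF assms(2)[OF that]] by (simp add: P_def column_def vec_eq_iff)
      then show ?thesis
        by (simp add: vec_eq_iff matrix_matrix_mult_def matrix_vector_mult_def column_def axis_def mat_def)
    qed
    then show ?thesis by (rule matrix_inv_eqI)
  qed
  moreover have "continuous_on S P"
    unfolding P_def
  proof (intro continuous_on_vec_lambda continuous_on_divide continuous_on_det)
    show "continuous_on S (\<lambda>x. if j = k then axis l 1 $ i else A x $ i $ j)" for i j k l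
      by (cases "j = k") (auto intro!: continuous_intros assms)
  qed (use assms in auto)
  ultimately show ?thesis by (simp cong: continuous_on_cong)
qed

section \<open>The strong maximum principle for second derivatives\<close>

lemma second_derivative_nonpos_at_max:
  fixes f f' :: "real \<Rightarrow> real"
  assumes "d > 0"
    and f: "\<And>t. \<bar>t\<bar> < d \<Longrightarrow> (f has_real_derivative f' t) (at t)"
    and f': "(f' has_real_derivative c) (at 0)"
    and max: "\<And>t. \<bar>t\<bar> < d \<Longrightarrow> f t \<le> f 0"
  shows "c \<le> 0"
proof (rule ccontr)
  assume "\<not> c \<le> 0"
  \<comment> \<open>Only the derivative of \<open>f'\<close> at 0 is given, so the mean value
    theorem replaces a Taylor expansion: \<open>f'\<close> vanishes at 0 and is positive just to the
    right, which makes \<open>f\<close> exceed \<open>f 0\<close> there.\<close>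
  then obtain e where e: "e > 0" "\<And>h. 0 < h \<Longrightarrow> h < e \<Longrightarrow> f' 0 < f' (0 + h)"
    using DERIV_pos_inc_right[OF f'] by auto
  have "f' 0 = 0"
    using DERIV_local_max[OF f[of 0] \<open>d > 0\<close>] max \<open>d > 0\<close> by auto
  define s where "s = min d e / 2"
  have s: "0 < s" "s < d" "s < e" using e(1) \<open>d > 0\<close> by (auto simp: s_def)
  obtain z where "0 < z" "z < s" "f s - f 0 = (s - 0) * f' z"
    using MVT2[OF s(1), of f f'] f s by (metis abs_of_nonneg order.strict_trans1)
  then have "f s > f 0" using e(2)[of z] s \<open>f' 0 = 0\<close> by (simp add: field_simps)
  then show False using max[of s] s by simp
qed

lemma has_vector_derivative_along_line:
  fixes f :: "'a::real_normed_vector \<Rightarrow> 'b::real_normed_vector"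
  assumes "(f has_derivative D) (at (x + t *\<^sub>R e))"
  shows "((\<lambda>s. f (x + s *\<^sub>R e)) has_vector_derivative D e) (at t)"
proof -
  have "((\<lambda>s. x + s *\<^sub>R e) has_derivative (\<lambda>s. s *\<^sub>R e)) (at t)"
    by (auto intro!: derivative_eq_intros)
  from has_derivative_compose[OF this assms] show ?thesis
    using linear_scale[OF has_derivative_linear[OF assms]]
    by (simp add: has_vector_derivative_def)
qed

lemma has_real_derivative_inner_along_line:
  fixes F :: "real^'n \<Rightarrow> real^'n"
  assumes "(F has_derivative D) (at (x + t *\<^sub>R e))"
  shows "((\<lambda>s. F (x + s *\<^sub>R e) \<bullet> w) has_real_derivative w \<bullet> D e) (at t)"
  using has_vector_derivative_along_line[OF has_derivative_inner_left[OF assms, of w]]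
  by (simp add: has_real_derivative_iff_has_vector_derivative inner_commute)

lemma open_contains_short_segment:
  fixes x :: "'a::real_normed_vector"
  assumes "open U" "x \<in> U"
  obtains d where "d > 0" "\<And>t. \<bar>t\<bar> < d \<Longrightarrow> x + t *\<^sub>R \<xi> \<in> U"
proof -
  have "((\<lambda>t. x + t *\<^sub>R \<xi>) \<longlongrightarrow> x + 0 *\<^sub>R \<xi>) (at 0)" by (intro tendsto_intros)
  then have "\<forall>\<^sub>F t in at 0. x + t *\<^sub>R \<xi> \<in> U"
    using assms by (auto intro: topological_tendstoD)
  then obtain d where "d > 0" "\<And>t. \<bar>t\<bar> < d \<Longrightarrow> x + t *\<^sub>R \<xi> \<in> U"
    using assms(2) unfolding eventually_at by (metis diff_zero dist_real_def scaleR_zero_left add_0_right UNIV_I)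
  then show thesis by (rule that)
qed

lemma hessian_nonpos_at_max:
  fixes \<psi> :: "real^'n \<Rightarrow> real" and G :: "real^'n \<Rightarrow> real^'n" and N :: "real^'n^'n"
  assumes "open U" "x \<in> U"
    and \<psi>: "\<And>y. y \<in> U \<Longrightarrow> (\<psi> has_derivative (\<lambda>\<xi>. G y \<bullet> \<xi>)) (at y)"
    and G: "(G has_derivative (*v) N) (at x)"
    and max: "\<And>y. y \<in> U \<Longrightarrow> \<psi> y \<le> \<psi> x"
  shows "\<xi> \<bullet> (N *v \<xi>) \<le> 0"
proof -
  obtain d where d: "d > 0" "\<And>t. \<bar>t\<bar> < d \<Longrightarrow> x + t *\<^sub>R \<xi> \<in> U"
    using open_contains_short_segment[OF assms(1,2)] by blast
  show ?thesis
  proof (rule second_derivative_nonpos_at_max[OF d(1)])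
    show "((\<lambda>t. \<psi> (x + t *\<^sub>R \<xi>)) has_real_derivative G (x + t *\<^sub>R \<xi>) \<bullet> \<xi>) (at t)" if "\<bar>t\<bar> < d" for t
      using has_vector_derivative_along_line[OF \<psi>[OF d(2)[OF that]]]
      by (simp add: has_real_derivative_iff_has_vector_derivative)
    show "((\<lambda>t. G (x + t *\<^sub>R \<xi>) \<bullet> \<xi>) has_real_derivative \<xi> \<bullet> (N *v \<xi>)) (at 0)"
      using G by (intro has_real_derivative_inner_along_line) simp
    show "\<psi> (x + t *\<^sub>R \<xi>) \<le> \<psi> (x + 0 *\<^sub>R \<xi>)" if "\<bar>t\<bar> < d" for t
      using max d(2)[OF that] by simp
  qed
qed

text \<open>The sum \<open>k\<close> of the two shifted values is even in \<open>t\<close>, so its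
  first derivative vanishes at 0 and the second-order Maclaurin formula leaves only the remainder,
  the mean of two second derivatives.\<close>

lemma second_difference_mean_value:
  fixes \<phi> :: "real^'n \<Rightarrow> real" and F :: "real^'n \<Rightarrow> real^'n" and A :: "real^'n \<Rightarrow> real^'n^'n"
  assumes "h > 0"
    and U: "\<And>t. \<bar>t\<bar> \<le> h \<Longrightarrow> x + t *\<^sub>R e \<in> U"
    and \<phi>: "\<And>y. y \<in> U \<Longrightarrow> (\<phi> has_derivative (\<lambda>\<xi>. F y \<bullet> \<xi>)) (at y)"
    and F: "\<And>y. y \<in> U \<Longrightarrow> (F has_derivative (*v) (A y)) (at y)"
  obtains t where "0 < t" "t \<le> h"
    "(\<phi> (x + h *\<^sub>R e) + \<phi> (x - h *\<^sub>R e) - 2 * \<phi> x) / h\<^sup>2 =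
       (e \<bullet> (A (x + t *\<^sub>R e) *v e) + e \<bullet> (A (x - t *\<^sub>R e) *v e)) / 2"
proof -
  define k where "k t = \<phi> (x + t *\<^sub>R e) + \<phi> (x - t *\<^sub>R e)" for t
  define k' where "k' t = F (x + t *\<^sub>R e) \<bullet> e - F (x - t *\<^sub>R e) \<bullet> e" for t
  define k'' where "k'' t = e \<bullet> (A (x + t *\<^sub>R e) *v e) + e \<bullet> (A (x - t *\<^sub>R e) *v e)" for t
  have U': "x + t *\<^sub>R e \<in> U" "x + t *\<^sub>R - e \<in> U" if "0 \<le> t" "t \<le> h" for t
    using U[of t] U[of "- t"] that by auto
  have k: "(k has_real_derivative k' t) (at t)" if "0 \<le> t" "t \<le> h" for t
    using DERIV_add[OF
        has_vector_derivative_along_line[OF \<phi>[OF U'(1)[OF that]], folded has_real_derivative_iff_has_vector_derivative]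
        has_vector_derivative_along_line[OF \<phi>[OF U'(2)[OF that]], folded has_real_derivative_iff_has_vector_derivative]]
    unfolding k_def[abs_def] k'_def by simp
  have k': "(k' has_real_derivative k'' t) (at t)" if "0 \<le> t" "t \<le> h" for t
    using DERIV_diff[OF
        has_real_derivative_inner_along_line[OF F[OF U'(1)[OF that]], of e]
        has_real_derivative_inner_along_line[OF F[OF U'(2)[OF that]], of e]]
    unfolding k'_def[abs_def] k''_def by (simp add: vec.neg)
  define D where "D m = (if m = 0 then k else if m = 1 then k' else k'')" for m :: nat
  have "\<exists>t. 0 < t \<and> t \<le> h \<and> k h = (\<Sum>m<2. D m 0 / fact m * h ^ m) + D 2 t / fact 2 * h ^ 2"
  proof (rule Maclaurin2[OF \<open>h > 0\<close>])
    show "\<forall>m t. m < 2 \<and> 0 \<le> t \<and> t \<le> h \<longrightarrow> (D m has_real_derivative D (Suc m) t) (at t)"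
      using k k' by (auto simp: D_def less_2_cases_iff)
  qed (simp add: D_def)
  then obtain t where t: "0 < t" "t \<le> h" "k h = (\<Sum>m<2. D m 0 / fact m * h ^ m) + D 2 t / fact 2 * h ^ 2"
    by blast
  have "k h = 2 * \<phi> x + k'' t / 2 * h\<^sup>2"
    using t(3) by (simp add: D_def numeral_2_eq_2 k_def k'_def)
  then have "(k h - 2 * \<phi> x) / h\<^sup>2 = k'' t / 2" using \<open>h > 0\<close> by (simp add: field_simps)
  then show ?thesis using that[OF t(1,2)] by (simp add: k_def k''_def)
qed

section \<open>Maximum principles for a Hessian of determinant 1\<close>

locale unimodular_hessian =
  fixes U :: "(real^'n) set" and \<phi> :: "real^'n \<Rightarrow> real" and F :: "real^'n \<Rightarrow> real^'n"
    and A :: "real^'n \<Rightarrow> real^'n^'n"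
  assumes open_domain: "open U"
    and gradient: "x \<in> U \<Longrightarrow> (\<phi> has_derivative (\<lambda>\<xi>. F x \<bullet> \<xi>)) (at x)"
    and hessian: "x \<in> U \<Longrightarrow> (F has_derivative (*v) (A x)) (at x)"
    and continuous_hessian: "continuous_on U A"
    and posdef_hessian: "x \<in> U \<Longrightarrow> posdef (A x)"
    and det_hessian: "x \<in> U \<Longrightarrow> det (A x) = 1"
begin

lemma continuous_second_derivative: "continuous_on U (\<lambda>x. e \<bullet> (A x *v e))"
  unfolding inner_vec_def matrix_vector_mult_def
  by (simp, intro continuous_intros continuous_hessian)

text \<open>By \<open>second_difference_mean_value\<close> the quotient averages second derivatives
  at two points within distance \<open>h * norm e\<close> of \<open>x\<close>. Uniform continuity on
  a compact neighbourhood of \<open>K\<close> lets one \<open>h\<close> serve all of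
  \<open>K\<close>.\<close>

lemma second_difference_approximation:
  assumes K: "compact K" "K \<subseteq> U" and "\<eta> > 0"
  obtains h where "h > 0"
    "\<And>x t. x \<in> K \<Longrightarrow> \<bar>t\<bar> \<le> h \<Longrightarrow> x + t *\<^sub>R e \<in> U"
    "\<And>x. x \<in> K \<Longrightarrow> \<bar>(\<phi> (x + h *\<^sub>R e) + \<phi> (x - h *\<^sub>R e) - 2 * \<phi> x) / h\<^sup>2 - e \<bullet> (A x *v e)\<bar> < \<eta>"
proof -
  define g where "g x = e \<bullet> (A x *v e)" for x
  obtain d where d: "d > 0" "(\<Union>x\<in>K. cball x d) \<subseteq> U"
    using compact_subset_open_imp_cball_epsilon_subset[OF K(1) open_domain K(2)] by blast
  define K' where "K' = (\<lambda>(x, y). x + y) ` (K \<times> cball 0 d)"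
  have "compact K'" unfolding K'_def split_def
    by (intro compact_continuous_image compact_Times K compact_cball continuous_intros)
  moreover have "K' \<subseteq> U"
  proof
    fix z assume "z \<in> K'"
    then obtain x y where xy: "x \<in> K" "norm y \<le> d" "z = x + y" by (auto simp: K'_def)
    then have "z \<in> cball x d" by (simp add: dist_norm)
    then show "z \<in> U" using xy d(2) by blast
  qed
  ultimately have "uniformly_continuous_on K' g"
    unfolding g_def using continuous_on_subset[OF continuous_second_derivative] compact_uniformly_continuous by blast
  then obtain \<delta> where \<delta>: "\<delta> > 0" "\<And>x y. x \<in> K' \<Longrightarrow> y \<in> K' \<Longrightarrow> dist y x < \<delta> \<Longrightarrow> dist (g y) (g x) < \<eta>"
    using \<open>\<eta> > 0\<close> unfolding uniformly_continuous_on_def by blast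
  \<comment> \<open>The summand 1 keeps the divisor positive when \<open>e\<close> is 0; the factor
    2 in \<open>h\<close> keeps displacements strictly below \<open>min d \<delta>\<close>.\<close>
  define a where "a = norm e + 1"
  define h where "h = min d \<delta> / (2 * a)"
  have ne: "a > 0" unfolding a_def by (smt (verit) norm_ge_zero)
  have h: "h > 0" using d(1) \<delta>(1) ne by (simp add: h_def)
  have small: "norm (t *\<^sub>R e) < min d \<delta>" if "\<bar>t\<bar> \<le> h" for t
  proof -
    have "norm (t *\<^sub>R e) \<le> h * a"
      using that h by (simp add: mult_mono a_def)
    also have "\<dots> = min d \<delta> / 2" using ne by (simp add: h_def)
    also have "\<dots> < min d \<delta>" using d(1) \<delta>(1) by linarith
    finally show ?thesis .
  qed
  have inK': "x + t *\<^sub>R e \<in> K'" if "x \<in> K" "\<bar>t\<bar> \<le> h" for x t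
    using small[OF that(2)] that(1) unfolding K'_def by (intro image_eqI[of _ _ "(x, t *\<^sub>R e)"]) auto
  then have inU: "x + t *\<^sub>R e \<in> U" if "x \<in> K" "\<bar>t\<bar> \<le> h" for x t
    using that \<open>K' \<subseteq> U\<close> by blast
  have "\<bar>(\<phi> (x + h *\<^sub>R e) + \<phi> (x - h *\<^sub>R e) - 2 * \<phi> x) / h\<^sup>2 - g x\<bar> < \<eta>" if x: "x \<in> K" for x
  proof -
    obtain t where t: "0 < t" "t \<le> h"
      "(\<phi> (x + h *\<^sub>R e) + \<phi> (x - h *\<^sub>R e) - 2 * \<phi> x) / h\<^sup>2 = (g (x + t *\<^sub>R e) + g (x - t *\<^sub>R e)) / 2"
      using second_difference_mean_value[OF h inU[OF x] gradient hessian] unfolding g_def by blast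
    have "\<bar>g (x + s *\<^sub>R e) - g x\<bar> < \<eta>" if "\<bar>s\<bar> \<le> h" for s
      using \<delta>(2)[OF inK'[OF x, of 0] inK'[OF x that]] small[OF that] h
      by (simp add: dist_norm)
    from this[of t] this[of "- t"] show ?thesis using t(1,2) unfolding t(3) abs_less_iff by (simp add: field_simps)
  qed
  with that h inU show ?thesis unfolding g_def by blast
qed

text \<open>Second difference quotients replace the second derivative, which need not be differentiable
  twice. They are subsolutions of the linearized equation because \<open>trace (matrix_inv A ** B) \<ge> n\<close>
  for positive definite \<open>A\<close> and \<open>B\<close> of determinant 1.\<close>

lemma weak_maximum_principle:
  fixes v :: "real^'n \<Rightarrow> real"
  assumes "\<rho> > 0" and cball: "cball x0 \<rho> \<subseteq> U"
    and v: "\<And>x. (v has_derivative (\<lambda>\<xi>. G x \<bullet> \<xi>)) (at x)"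
    and G: "\<And>x. (G has_derivative (*v) (V x)) (at x)"
    and symV: "\<And>x. transpose (V x) = V x"
    and pos: "\<And>x. x \<in> cball x0 \<rho> \<Longrightarrow> trace (matrix_inv (A x) ** V x) > 0"
  obtains y where "y \<in> sphere x0 \<rho>" "e \<bullet> (A y *v e) + v y \<ge> e \<bullet> (A x0 *v e) + v x0"
proof (rule ccontr)
  define g where "g x = e \<bullet> (A x *v e)" for x
  assume no: "\<not> thesis"
  note solution = that
  have lt: "g y + v y < g x0 + v x0" if "y \<in> sphere x0 \<rho>" for y
    using solution[OF that] no unfolding g_def by linarith
  have contv: "continuous_on S v" for S
    by (rule has_derivative_continuous_on[OF has_derivative_at_withinI[OF v]])
  have "continuous_on (sphere x0 \<rho>) g"
    unfolding g_def using cball sphere_cball continuous_on_subset[OF continuous_second_derivative] by blast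
  moreover have "sphere x0 \<rho> \<noteq> {}" using \<open>\<rho> > 0\<close> by simp
  ultimately obtain y0 where y0: "y0 \<in> sphere x0 \<rho>" "\<And>y. y \<in> sphere x0 \<rho> \<Longrightarrow> g y + v y \<le> g y0 + v y0"
    using continuous_attains_sup[OF compact_sphere, of x0 \<rho> "\<lambda>x. g x + v x"] continuous_on_add[OF _ contv] by blast
  \<comment> \<open>Half the gap: any approximation of \<open>g + v\<close> within
    \<open>\<eta>\<close> is still larger at \<open>x0\<close> than everywhere on the sphere, so its
    maximum over the closed ball is interior.\<close>
  define \<eta> where "\<eta> = (g x0 + v x0 - (g y0 + v y0)) / 2"
  have "\<eta> > 0" using lt[OF y0(1)] by (simp add: \<eta>_def)
  obtain h where h: "h > 0"
    and inU: "\<And>x t. x \<in> cball x0 \<rho> \<Longrightarrow> \<bar>t\<bar> \<le> h \<Longrightarrow> x + t *\<^sub>R e \<in> U"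
    and approx: "\<And>x. x \<in> cball x0 \<rho> \<Longrightarrow> \<bar>(\<phi> (x + h *\<^sub>R e) + \<phi> (x - h *\<^sub>R e) - 2 * \<phi> x) / h\<^sup>2 - g x\<bar> < \<eta>"
    using second_difference_approximation[OF compact_cball cball \<open>\<eta> > 0\<close>, of e] unfolding g_def by blast
  define \<psi> where "\<psi> x = inverse (h\<^sup>2) * (\<phi> (x + h *\<^sub>R e) + \<phi> (x - h *\<^sub>R e) - 2 * \<phi> x) + v x" for x
  have \<psi>_approx: "\<bar>\<psi> x - (g x + v x)\<bar> < \<eta>" if "x \<in> cball x0 \<rho>" for x
    using approx[OF that] by (simp add: \<psi>_def divide_inverse mult.commute)
  define \<Psi> where "\<Psi> x = (F (x + h *\<^sub>R e) + F (x - h *\<^sub>R e) - 2 *\<^sub>R F x) /\<^sub>R h\<^sup>2 + G x" for x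
  define N where "N x = (A (x + h *\<^sub>R e) + A (x - h *\<^sub>R e) - 2 *\<^sub>R A x) /\<^sub>R h\<^sup>2 + V x" for x
  have U3: "x \<in> U" "x + h *\<^sub>R e \<in> U" "x - h *\<^sub>R e \<in> U" if "x \<in> cball x0 \<rho>" for x
    using inU[OF that, of 0] inU[OF that, of h] inU[OF that, of "- h"] h by auto
  have shift: "((\<lambda>x. f (x + c)) has_derivative f') (at x)" if "(f has_derivative f') (at (x + c))"
    for f :: "real^'n \<Rightarrow> 'b::real_normed_vector" and f' x c
  proof -
    have "((\<lambda>x. x + c) has_derivative (\<lambda>\<xi>. \<xi>)) (at x)" by (auto intro!: derivative_eq_intros)
    from has_derivative_compose[OF this that] show ?thesis .
  qed
  have shift': "((\<lambda>x. f (x - c)) has_derivative f') (at x)" if "(f has_derivative f') (at (x - c))"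
    for f :: "real^'n \<Rightarrow> 'b::real_normed_vector" and f' x c
    using shift[of f f' x "- c"] that by simp
  have d\<psi>: "(\<psi> has_derivative (\<lambda>\<xi>. \<Psi> x \<bullet> \<xi>)) (at x)" if "x \<in> cball x0 \<rho>" for x
    unfolding \<psi>_def[abs_def] \<Psi>_def
    by (rule has_derivative_eq_rhs[OF has_derivative_add[OF has_derivative_mult_right[OF
          has_derivative_diff[OF has_derivative_add[OF
            shift[OF gradient[OF U3(2)[OF that]]] shift'[OF gradient[OF U3(3)[OF that]]]]
            has_derivative_mult_right[OF gradient[OF U3(1)[OF that]]]]] v]])
      (simp add: fun_eq_iff inner_add_left inner_diff_left)
  have d\<Psi>: "(\<Psi> has_derivative (*v) (N x)) (at x)" if "x \<in> cball x0 \<rho>" for x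
    unfolding \<Psi>_def[abs_def] N_def
    by (rule has_derivative_eq_rhs[OF has_derivative_add[OF has_derivative_scaleR_right[OF
          has_derivative_diff[OF has_derivative_add[OF
            shift[OF hessian[OF U3(2)[OF that]]] shift'[OF hessian[OF U3(3)[OF that]]]]
            has_derivative_scaleR_right[OF hessian[OF U3(1)[OF that]]]]] G]])
      (simp add: fun_eq_iff matrix_vector_mult_add_rdistrib matrix_vector_mult_diff_rdistrib
        scaleR_matrix_vector_assoc[symmetric])
  have "continuous_on (cball x0 \<rho>) \<psi>"
    by (rule has_derivative_continuous_on[OF has_derivative_at_withinI[OF d\<psi>]])
  moreover have "cball x0 \<rho> \<noteq> {}" using \<open>\<rho> > 0\<close> by simp
  ultimately obtain x where x: "x \<in> cball x0 \<rho>" "\<And>y. y \<in> cball x0 \<rho> \<Longrightarrow> \<psi> y \<le> \<psi> x"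
    using continuous_attains_sup[OF compact_cball] by blast
  have "x \<notin> sphere x0 \<rho>"
  proof
    assume "x \<in> sphere x0 \<rho>"
    then have "\<psi> x < g y0 + v y0 + \<eta>" using y0(2)[of x] \<psi>_approx[OF x(1)] by simp
    moreover have "\<psi> x \<ge> \<psi> x0" using x(2)[of x0] \<open>\<rho> > 0\<close> by simp
    moreover have "\<psi> x0 > g x0 + v x0 - \<eta>" using \<psi>_approx[of x0] \<open>\<rho> > 0\<close> by simp
    ultimately show False by (simp add: \<eta>_def field_simps)
  qed
  then have xb: "x \<in> ball x0 \<rho>" using x(1) by auto
  have "\<xi> \<bullet> (N x *v \<xi>) \<le> 0" for \<xi>
    by (rule hessian_nonpos_at_max[OF open_ball xb d\<psi> d\<Psi>[OF x(1)]]) (auto intro: x(2))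
  moreover have "transpose (N x) = N x"
  proof -
    have "transpose (A y) = A y" if "y \<in> U" for y using posdef_hessian[OF that] by (simp add: posdef_def)
    from this[OF U3(1)[OF x(1)]] this[OF U3(2)[OF x(1)]] this[OF U3(3)[OF x(1)]] symV[of x]
    show ?thesis by (simp add: N_def vec_eq_iff transpose_def)
  qed
  ultimately have "trace (matrix_inv (A x) ** N x) \<le> 0"
    by (intro trace_inverse_mult_nonpos posdef_hessian U3(1) x(1))
  \<comment> \<open>Each shifted Hessian contributes at least \<open>CARD('n)\<close> and the centre
    exactly minus twice that, so the difference part is nonnegative; the strictly positive part from
    \<open>V\<close> contradicts the bound at the maximum.\<close>
  moreover have "trace (matrix_inv (A x) ** N x) =
    (trace (matrix_inv (A x) ** A (x + h *\<^sub>R e)) + trace (matrix_inv (A x) ** A (x - h *\<^sub>R e))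
      - 2 * trace (matrix_inv (A x) ** A x)) / h\<^sup>2 + trace (matrix_inv (A x) ** V x)"
    unfolding N_def trace_def matrix_matrix_mult_def
    by (simp add: sum.distrib sum_subtractf algebra_simps sum_distrib_left sum_divide_distrib divide_inverse)
  moreover have "trace (matrix_inv (A x) ** A x) = real CARD('n)"
  proof -
    have "invertible (A x)" using det_hessian[OF U3(1)[OF x(1)]] by (simp add: invertible_det_nz)
    then show ?thesis by (simp add: matrix_inv_mult_left trace_I)
  qed
  moreover have "trace (matrix_inv (A x) ** A (x + h *\<^sub>R e)) \<ge> real CARD('n)"
    "trace (matrix_inv (A x) ** A (x - h *\<^sub>R e)) \<ge> real CARD('n)"
    by (intro trace_inverse_mult_ge posdef_hessian det_hessian U3 x(1))+
  then have "(trace (matrix_inv (A x) ** A (x + h *\<^sub>R e)) + trace (matrix_inv (A x) ** A (x - h *\<^sub>R e))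
      - 2 * real CARD('n)) / h\<^sup>2 \<ge> 0" by (intro divide_nonneg_nonneg) auto
  ultimately show False using pos[OF x(1)] by simp
qed

text \<open>Hopf's argument. If the second derivative were smaller at \<open>z\<close>, the largest
  ball about \<open>z\<close> on which it stays below its maximum would touch the maximum set at a
  point \<open>p\<close>. Adding a small multiple of an exponential barrier makes the value at
  \<open>p\<close> exceed all values on a small sphere around \<open>p\<close>, against
  \<open>weak_maximum_principle\<close>.\<close>

lemma local_strong_maximum_principle:
  assumes "r > 0" and ball: "ball x0 r \<subseteq> U"
    and le: "\<And>x. x \<in> ball x0 r \<Longrightarrow> e \<bullet> (A x *v e) \<le> e \<bullet> (A x0 *v e)"
    and z: "z \<in> ball x0 (r / 4)"
  shows "e \<bullet> (A z *v e) = e \<bullet> (A x0 *v e)"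
proof (rule ccontr)
  assume neq: "e \<bullet> (A z *v e) \<noteq> e \<bullet> (A x0 *v e)"
  define g where "g x = e \<bullet> (A x *v e)" for x
  \<comment> \<open>The closed ball supplies the compactness needed for a nearest point. As
    \<open>x0\<close> lies in \<open>K\<close> and \<open>z\<close> within \<open>r / 4\<close> of
    \<open>x0\<close>, all points closer to \<open>z\<close> than \<open>K\<close> lie within
    \<open>r / 2\<close> of \<open>x0\<close>, so they fail to be in \<open>K\<close> only by their
    value of \<open>g\<close>.\<close>
  define K where "K = {x \<in> cball x0 (r / 2). g x = g x0}"
  have cont: "continuous_on S g" if "S \<subseteq> U" for S
    unfolding g_def using continuous_on_subset[OF continuous_second_derivative that] .
  have half: "cball x0 (r / 2) \<subseteq> ball x0 r" using \<open>r > 0\<close> by auto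
  have "closedin (top_of_set (cball x0 (r / 2))) (cball x0 (r / 2) \<inter> g -` {g x0})"
    by (intro continuous_closedin_preimage cont closed_singleton order_trans[OF half ball])
  then have "compact K"
    using closedin_compact[OF compact_cball] by (simp add: K_def vimage_def Int_def)
  moreover have "x0 \<in> K" using \<open>r > 0\<close> by (simp add: K_def)
  ultimately obtain p where p: "p \<in> K" "\<And>x. x \<in> K \<Longrightarrow> dist z p \<le> dist z x"
    using distance_attains_inf[OF compact_imp_closed, of K z] by blast
  define R where "R = dist z p"
  have "R < r / 4" using p(2)[OF \<open>x0 \<in> K\<close>] z by (simp add: R_def dist_commute)
  have "R > 0"
    using neq p(1) unfolding R_def K_def g_def by auto
  have outside: "g x < g x0" if "dist z x < R" for x
  proof -
    have "dist x0 x \<le> dist x0 z + dist z x" by (rule dist_triangle)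
    then have "x \<in> cball x0 (r / 2)" using that z \<open>R < r / 4\<close> by simp
    moreover have "x \<notin> K" using p(2)[of x] that by (auto simp: R_def)
    ultimately have "g x \<noteq> g x0" "x \<in> ball x0 r" using half by (auto simp: K_def)
    then show ?thesis using le[of x] by (simp add: g_def)
  qed
  txt \<open>Shrinking the touching ball to half its radius makes \<open>p\<close> the only contact point.\<close>
  define b where "b = (1/2) *\<^sub>R (p - z)"
  define c where "c = p - b"
  define a where "a = p - c"
  have "a = b" by (simp add: a_def c_def)
  then have "norm a = R / 2" by (simp add: b_def R_def dist_norm norm_minus_commute)
  moreover have "b + b = p - z" unfolding b_def by (simp flip: scaleR_add_left)
  then have "z = c - a" by (simp add: a_def c_def algebra_simps)
  ultimately have a: "norm a = R / 2" "z = c - a" by blast+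
  have inner_lt: "g x < g x0" if "norm (x - c) \<le> R / 2" "x \<noteq> p" for x
  proof (rule outside)
    \<comment> \<open>Parallelogram law: \<open>x - c + a\<close> is \<open>x - z\<close> and
      \<open>x - c - a\<close> is \<open>x - p\<close>, so \<open>x \<noteq> p\<close> makes the
      distance to \<open>z\<close> strictly less than \<open>R\<close>.\<close>
    have "(norm (x - c + a))\<^sup>2 + (norm (x - c - a))\<^sup>2 = 2 * (norm (x - c))\<^sup>2 + 2 * (norm a)\<^sup>2"
      by (simp add: power2_norm_eq_inner inner_add_left inner_add_right inner_diff_left inner_diff_right
          inner_commute)
    moreover have "(norm (x - c - a))\<^sup>2 > 0" using that(2) by (simp add: a_def)
    moreover have "(norm (x - c))\<^sup>2 \<le> (R / 2)\<^sup>2" using that(1) by (intro power_mono) auto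
    ultimately have "(norm (x - c + a))\<^sup>2 < R\<^sup>2" unfolding a(1) by (simp add: power2_eq_square)
    then have "norm (x - c + a) < R" using \<open>R > 0\<close> by (simp add: power_less_imp_less_base)
    then show "dist z x < R" by (simp add: a(2) dist_norm norm_minus_commute algebra_simps)
  qed
  have pb: "p \<in> ball x0 r" "p \<in> U" "g p = g x0" using p(1) half ball by (auto simp: K_def)
  define P where "P x = matrix_inv (A x)" for x
  have contP: "continuous_on U P" unfolding P_def
    by (rule continuous_on_matrix_inv[OF continuous_hessian]) (simp add: det_hessian)
  define q where "q x = (x - c) \<bullet> (P x *v (x - c))" for x
  have contq: "continuous_on U q" and contt: "continuous_on U (\<lambda>x. trace (P x))"
    unfolding q_def inner_vec_def matrix_vector_mult_def trace_def
    by (simp, (intro continuous_intros contP)+)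
  have "p - c \<noteq> 0" using a(1) \<open>R > 0\<close> by (auto simp: a_def)
  then have q: "q p > 0" using posdef_matrix_inv[OF posdef_hessian[OF pb(2)]] by (simp add: q_def P_def posdef_def)
  \<comment> \<open>As \<open>traceV\<close> below shows, the linearized operator gives the barrier
    the sign of \<open>2 * \<alpha> * q x - trace (P x)\<close>. A large \<open>\<alpha>\<close>
    makes this positive at \<open>p\<close>, and continuity extends it to a ball around
    \<open>p\<close>.\<close>
  obtain \<alpha> where \<alpha>: "\<alpha> > 0" "2 * \<alpha> * q p > trace (P p)"
  proof -
    define \<alpha> where "\<alpha> = (\<bar>trace (P p)\<bar> + 1) / (2 * q p)"
    have "2 * \<alpha> * q p = \<bar>trace (P p)\<bar> + 1" using q by (simp add: \<alpha>_def)
    then have "2 * \<alpha> * q p > trace (P p)" by linarith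
    moreover have "\<alpha> > 0" using q by (auto simp: \<alpha>_def intro!: divide_pos_pos)
    ultimately show thesis using that by blast
  qed
  have "continuous_on U (\<lambda>x. 2 * \<alpha> * q x - trace (P x))"
    by (intro continuous_intros contq contt)
  then have "open (U \<inter> (\<lambda>x. 2 * \<alpha> * q x - trace (P x)) -` {0<..})"
    using open_domain by (intro continuous_open_preimage) auto
  moreover have "p \<in> U \<inter> (\<lambda>x. 2 * \<alpha> * q x - trace (P x)) -` {0<..}" using \<alpha> pb by simp
  ultimately obtain \<rho>0 where \<rho>0: "\<rho>0 > 0"
    "cball p \<rho>0 \<subseteq> U \<inter> (\<lambda>x. 2 * \<alpha> * q x - trace (P x)) -` {0<..}"
    unfolding open_contains_cball by blast
  obtain \<rho>1 where \<rho>1: "\<rho>1 > 0" "cball p \<rho>1 \<subseteq> ball x0 r"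
    using pb(1) open_ball open_contains_cball by blast
  define \<rho> where "\<rho> = min \<rho>0 \<rho>1"
  have \<rho>: "\<rho> > 0" "cball p \<rho> \<subseteq> U" "cball p \<rho> \<subseteq> ball x0 r"
    "\<And>x. x \<in> cball p \<rho> \<Longrightarrow> 2 * \<alpha> * q x - trace (P x) > 0"
    using \<rho>0 \<rho>1 by (auto simp: \<rho>_def)
  define E where "E x = exp (- \<alpha> * ((x - c) \<bullet> (x - c)))" for x
  \<comment> \<open>The barrier: positive in the ball of radius \<open>R / 2\<close> about
    \<open>c\<close>, negative outside its closure, and zero on its boundary, where \<open>p\<close>
    lies.\<close>
  define b where "b x = E x - E p" for x
  have b_nonneg: "norm (x - c) \<le> R / 2" if "b x \<ge> 0" for x
  proof -
    have "(norm (x - c))\<^sup>2 \<le> (norm a)\<^sup>2"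
      using that \<open>\<alpha> > 0\<close> by (simp add: b_def E_def a_def power2_norm_eq_inner)
    then show ?thesis using a(1) by (metis norm_ge_zero power2_le_imp_le)
  qed
  \<comment> \<open>The sphere around \<open>p\<close> splits in two. On \<open>S\<close> the
    barrier is nonnegative, but \<open>S\<close> is compact, misses \<open>p\<close> and lies in the
    shrunken ball, so \<open>g\<close> keeps a definite distance from its maximum. Off
    \<open>S\<close> the negative barrier lowers the sum by itself.\<close>
  define S where "S = {x \<in> sphere p \<rho>. b x \<ge> 0}"
  have contb: "continuous_on T b" for T
    unfolding b_def E_def by (intro continuous_intros)
  have "closedin (top_of_set (sphere p \<rho>)) (sphere p \<rho> \<inter> b -` {0..})"
    by (intro continuous_closedin_preimage contb closed_atLeast)
  then have "compact S"
    using closedin_compact[OF compact_sphere] by (simp add: S_def vimage_def Int_def)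
  have S_lt: "g x < g x0" if "x \<in> S" for x
    using that \<rho>(1) by (intro inner_lt b_nonneg) (auto simp: S_def)
  obtain M where M: "M < g x0" "\<And>x. x \<in> S \<Longrightarrow> g x \<le> M"
  proof (cases "S = {}")
    case True
    then show ?thesis using that[of "g x0 - 1"] by simp
  next
    case False
    have "S \<subseteq> U" using \<rho>(2) by (auto simp: S_def)
    then obtain s where "s \<in> S" "\<And>x. x \<in> S \<Longrightarrow> g x \<le> g s"
      using continuous_attains_sup[OF \<open>compact S\<close> False cont] by blast
    then show ?thesis using that S_lt by blast
  qed
  \<comment> \<open>Since \<open>b \<le> 1\<close>, this weight raises \<open>g\<close> on
    \<open>S\<close> by at most half of the gap, while at \<open>p\<close> the barrier adds
    0.\<close>
  define \<epsilon> where "\<epsilon> = (g x0 - M) / 2"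
  have "\<epsilon> > 0" using M(1) by (simp add: \<epsilon>_def)
  have sphere_lt: "g y + \<epsilon> * b y < g p + \<epsilon> * b p" if y: "y \<in> sphere p \<rho>" for y
  proof (cases "b y \<ge> 0")
    case True
    have "b y \<le> 1" using \<open>\<alpha> > 0\<close> by (simp add: b_def E_def add_increasing2 diff_le_eq)
    then have "\<epsilon> * b y \<le> \<epsilon>" using \<open>\<epsilon> > 0\<close> by simp
    moreover have "g y \<le> M" using M(2)[of y] True y by (simp add: S_def)
    ultimately show ?thesis using pb(3) M(1) by (simp add: b_def \<epsilon>_def field_simps)
  next
    case False
    then have "\<epsilon> * b y < 0" using \<open>\<epsilon> > 0\<close> by (simp add: mult_pos_neg)
    moreover have "g y \<le> g x0" using le[of y] \<rho>(3) y by (auto simp: g_def)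
    ultimately show ?thesis using pb(3) by (simp add: b_def)
  qed
  \<comment> \<open>\<open>G\<close> and \<open>V\<close> are the gradient and Hessian of
    \<open>\<epsilon> * b\<close>; \<open>X w\<close> is the outer product of \<open>w\<close> with
    itself.\<close>
  define G where "G x = (- 2 * \<alpha> * \<epsilon> * E x) *\<^sub>R (x - c)" for x
  define X :: "real^'n \<Rightarrow> real^'n^'n" where "X w = (\<chi> i j. w $ i * w $ j)" for w
  define V where "V x = (\<epsilon> * E x) *\<^sub>R ((4 * \<alpha>\<^sup>2) *\<^sub>R X (x - c) - (2 * \<alpha>) *\<^sub>R mat 1)" for x
  have dE: "(E has_derivative (\<lambda>\<xi>. - 2 * \<alpha> * E x * ((x - c) \<bullet> \<xi>))) (at x)" for x
    unfolding E_def[abs_def]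
    by (rule derivative_eq_intros refl)+ (simp add: fun_eq_iff inner_commute)
  have dv: "((\<lambda>x. \<epsilon> * b x) has_derivative (\<lambda>\<xi>. G x \<bullet> \<xi>)) (at x)" for x
    unfolding b_def G_def
    by (rule derivative_eq_intros dE refl)+ (simp add: fun_eq_iff)
  have outer: "X w *v \<xi> = (w \<bullet> \<xi>) *\<^sub>R w" for w \<xi>
    by (simp add: X_def vec_eq_iff matrix_vector_mult_def inner_vec_def sum_distrib_left mult_ac)
  have V_mult: "V x *v \<xi> = (\<epsilon> * E x) *\<^sub>R ((4 * \<alpha>\<^sup>2 * ((x - c) \<bullet> \<xi>)) *\<^sub>R (x - c) - (2 * \<alpha>) *\<^sub>R \<xi>)" for x \<xi>
    by (simp add: V_def matrix_vector_mult_diff_rdistrib outer flip: scaleR_matrix_vector_assoc)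
  have dG: "(G has_derivative (*v) (V x)) (at x)" for x
    unfolding G_def[abs_def]
  proof (rule has_derivative_eq_rhs[OF has_derivative_scaleR[OF has_derivative_mult_right[OF dE]]])
    show "((\<lambda>x. x - c) has_derivative (\<lambda>\<xi>. \<xi>)) (at x)" by (auto intro!: derivative_eq_intros)
  qed (simp add: fun_eq_iff V_mult power2_eq_square scaleR_diff_right mult_ac)
  have traceV: "trace (P x ** V x) = 2 * \<alpha> * \<epsilon> * E x * (2 * \<alpha> * q x - trace (P x))" for x
  proof -
    have "trace (P x ** X (x - c)) = q x"
      by (simp add: X_def q_def trace_def matrix_matrix_mult_def inner_vec_def matrix_vector_mult_def
          sum_distrib_left mult_ac)
    moreover have "trace (P x ** V x) = \<epsilon> * E x * (4 * \<alpha>\<^sup>2 * trace (P x ** X (x - c))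
        - 2 * \<alpha> * trace (P x ** mat 1))"
      unfolding V_def trace_def matrix_matrix_mult_def
      by (simp add: sum_subtractf algebra_simps sum_distrib_left)
    ultimately show ?thesis by (simp add: power2_eq_square algebra_simps)
  qed
  have symV: "transpose (V x) = V x" for x
    by (simp add: V_def X_def vec_eq_iff transpose_def mat_def mult.commute)
  have posV: "trace (matrix_inv (A x) ** V x) > 0" if "x \<in> cball p \<rho>" for x
    using \<rho>(4)[OF that] \<open>\<epsilon> > 0\<close> \<alpha>(1) traceV[of x] by (simp add: P_def E_def)
  obtain y where "y \<in> sphere p \<rho>" "e \<bullet> (A y *v e) + \<epsilon> * b y \<ge> e \<bullet> (A p *v e) + \<epsilon> * b p"
    by (rule weak_maximum_principle[OF \<rho>(1,2) dv dG symV posV])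
  with sphere_lt[of y] show False by (simp add: g_def)
qed

end

section \<open>Null coordinates\<close>

text \<open>In the null coordinates \<open>u = x + y\<close>, \<open>v = x - y\<close> the quadratic form is \<open>u \<bullet> v\<close>, and
  \<open>dz = (1 + \<tau>)/2 du + (1 - \<tau>)/2 dv\<close> because \<open>(1 \<plusminus> \<tau>)/2\<close> are orthogonal idempotents.\<close>

definition null_u :: "'n::finite dspace \<Rightarrow> real^'n" where
  "null_u z = fst z + snd z"

definition null_v :: "'n::finite dspace \<Rightarrow> real^'n" where
  "null_v z = fst z - snd z"

definition null_point :: "real^'n \<Rightarrow> real^'n \<Rightarrow> 'n::finite dspace" where
  "null_point u v = ((1/2) *\<^sub>R (u + v), (1/2) *\<^sub>R (u - v))"

lemma null_coords [simp]: "null_u (null_point u v) = u" "null_v (null_point u v) = v"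
  by (simp_all add: null_u_def null_v_def null_point_def flip: scaleR_add_right scaleR_diff_right)

lemma null_point_coords [simp]: "null_point (null_u z) (null_v z) = z"
  by (simp add: null_u_def null_v_def null_point_def prod_eq_iff vec_eq_iff)

lemma null_eqI: "null_u z = null_u w \<Longrightarrow> null_v z = null_v w \<Longrightarrow> z = w"
  by (metis null_point_coords)

lemma bounded_linear_null_u: "bounded_linear null_u"
  unfolding null_u_def[abs_def] by (intro bounded_linear_add bounded_linear_fst bounded_linear_snd)

lemma bounded_linear_null_v: "bounded_linear null_v"
  unfolding null_v_def[abs_def] by (intro bounded_linear_sub bounded_linear_fst bounded_linear_snd)

lemma linear_null_u: "linear null_u"
  by (rule bounded_linear.linear[OF bounded_linear_null_u])

lemma linear_null_v: "linear null_v"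
  by (rule bounded_linear.linear[OF bounded_linear_null_v])

lemma linear_null_graph: "linear (\<lambda>u. null_point u (A *v u))"
  by (rule linearI) (simp_all add: null_point_def matrix_vector_right_distrib matrix_vector_mult_scaleR
      algebra_simps vec_eq_iff)

lemma split_inner_null: "split_inner z z = null_u z \<bullet> null_v z"
  by (simp add: split_inner_def null_u_def null_v_def inner_vec_def algebra_simps)

lemma omega_null: "2 * omega z w = null_u w \<bullet> null_v z - null_u z \<bullet> null_v w"
  by (simp add: omega_def null_u_def null_v_def inner_vec_def sum_distrib_left algebra_simps
      flip: sum_subtractf)

text \<open>Meant for the sum and the difference of \<open>dRe\<close> and \<open>dIm\<close>, two
  ring homomorphisms from the double numbers to the reals. The Leibniz formula uses only ring
  operations.\<close>

lemma det_ring_hom: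
  fixes h :: "'a::comm_ring_1 \<Rightarrow> 'b::comm_ring_1" and M :: "'a^'n^'n"
  assumes h: "h 1 = 1" "\<And>x y. h (x + y) = h x + h y" "\<And>x y. h (x * y) = h x * h y"
  shows "h (det M) = det (\<chi> i j. h (M $ i $ j))"
proof -
  have h0: "h 0 = 0" using h(2)[of 0 0] by simp
  have hneg: "h (- x) = - h x" for x using h(2)[of x "- x"] h0 by (simp add: eq_neg_iff_add_eq_0 add.commute)
  have hsum: "h (sum f S) = (\<Sum>x\<in>S. h (f x))" for f :: "('n \<Rightarrow> 'n) \<Rightarrow> 'a" and S
    by (induction S rule: infinite_finite_induct) (simp_all add: h0 h(2))
  have hprod: "h (prod f S) = (\<Prod>x\<in>S. h (f x))" for f :: "'n \<Rightarrow> 'a" and S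
    by (induction S rule: infinite_finite_induct) (simp_all add: h(1,3))
  have hsign: "h (of_int (sign p)) = of_int (sign p)" for p :: "'n \<Rightarrow> 'n"
    by (simp add: sign_def h(1) hneg)
  show ?thesis by (simp add: det_def hsum hprod hsign h(3))
qed

lemma dIm_dz_null:
  "2 * dIm (dz v) = det (\<chi> i j. null_u (v j) $ i) - det (\<chi> i j. null_v (v j) $ i)"
proof -
  have "dRe (dz v) + dIm (dz v) = det (\<chi> i j. null_u (v j) $ i)"
    using det_ring_hom[of "\<lambda>z. dRe z + dIm z" "\<chi> i j. dz_coord i (v j)"]
    by (simp add: dz_def dz_coord_def null_u_def one_double_def plus_double_def times_double_def algebra_simps)
  moreover have "dRe (dz v) - dIm (dz v) = det (\<chi> i j. null_v (v j) $ i)"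
    using det_ring_hom[of "\<lambda>z. dRe z - dIm z" "\<chi> i j. dz_coord i (v j)"]
    by (simp add: dz_def dz_coord_def null_v_def one_double_def plus_double_def times_double_def algebra_simps)
  ultimately show ?thesis by linarith
qed

section \<open>Planes as graphs over the null coordinate u\<close>

definition null_graph :: "real^'n^'n \<Rightarrow> 'n::finite dspace set" where
  "null_graph A = {w. null_v w = A *v null_u w}"

lemma subspace_null_graph: "subspace (null_graph A)"
  by (simp add: null_graph_def subspace_def linear_0[OF linear_null_u] linear_0[OF linear_null_v]
      linear_add[OF linear_null_u] linear_add[OF linear_null_v]
      linear_scale[OF linear_null_u] linear_scale[OF linear_null_v]
      matrix_vector_right_distrib matrix_vector_mult_scaleR)

lemma null_graph_eq_range: "null_graph A = range (\<lambda>u. null_point u (A *v u))"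
  unfolding null_graph_def image_def
  by (auto, metis null_point_coords)

lemma inj_null_graph: "inj (\<lambda>u. null_point u (A *v u))"
  by (metis (no_types, lifting) injI null_coords(1))

text \<open>A vector of \<open>P\<close> with \<open>null_u\<close> zero has
  \<open>split_inner\<close> zero, so spacelikeness makes \<open>P\<close> a graph over the
  \<open>u\<close> coordinate. The Lagrangian condition then says that \<open>A\<close> is
  symmetric, spacelikeness that it is positive, and the imaginary part, evaluated on a single frame,
  gives the determinant.\<close>

lemma plane_eq_null_graph:
  fixes b :: "'n::finite \<Rightarrow> 'n dspace"
  assumes b: "frame_of P b"
    and pos: "spacelike P"
    and lag: "\<And>v w. v \<in> P \<Longrightarrow> w \<in> P \<Longrightarrow> omega v w = 0"
    and im: "\<And>v. range v \<subseteq> P \<Longrightarrow> dIm (dz v) = 0"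
  obtains A where "posdef A" "det A = 1" "P = null_graph A"
proof -
  define comb where "comb c = (\<Sum>j\<in>UNIV. c $ j *\<^sub>R b j)" for c :: "real^'n"
  define U :: "real^'n^'n" where "U = (\<chi> i j. null_u (b j) $ i)"
  define V :: "real^'n^'n" where "V = (\<chi> i j. null_v (b j) $ i)"
  have inj: "inj b" and indep: "independent (range b)" and span: "span (range b) = P"
    using b by (auto simp: frame_of_def)
  have u_comb: "null_u (comb c) = U *v c" and v_comb: "null_v (comb c) = V *v c" for c
    unfolding comb_def U_def V_def
    by (simp_all add: linear_sum[OF linear_null_u] linear_sum[OF linear_null_v]
        linear_scale[OF linear_null_u] linear_scale[OF linear_null_v]
        vec_eq_iff matrix_vector_mult_def mult.commute)
  have comb_P: "comb c \<in> P" for c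
    unfolding comb_def span[symmetric] by (intro span_sum span_scale span_base) auto
  have P_comb: "\<exists>c. w = comb c" if "w \<in> P" for w
  proof -
    have "w \<in> span (range b)" using that span by simp
    then obtain k where "w = (\<Sum>a\<in>range b. k a *\<^sub>R a)"
      by (auto simp: span_finite)
    then have "w = comb (\<chi> j. k (b j))" by (simp add: comb_def sum.reindex[OF inj])
    then show ?thesis by blast
  qed
  have "c = 0" if "U *v c = 0" for c
  proof -
    have "split_inner (comb c) (comb c) = 0" by (simp add: split_inner_null u_comb that)
    then have "comb c = 0" using pos comb_P by (force simp: spacelike_def)
    \<comment> \<open>\<open>independentD\<close> speaks of coefficients on the set
      \<open>range b\<close>; \<open>inv b\<close> turns the coordinates of \<open>c\<close> into
      such coefficients.\<close>
    then have "(\<Sum>a\<in>range b. c $ (inv b a) *\<^sub>R a) = 0" by (simp add: comb_def sum.reindex[OF inj] inv_f_f[OF inj])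
    then have "\<forall>a\<in>range b. c $ (inv b a) = 0"
      using independentD[OF indep finite_imageI[OF finite] subset_refl, of "\<lambda>a. c $ (inv b a)"] by blast
    then show ?thesis by (simp add: vec_eq_iff inv_f_f[OF inj])
  qed
  then have "invertible U"
    by (metis invertible_left_inverse matrix_left_invertible_ker)
  define A where "A = V ** matrix_inv U"
  have AU: "A ** U = V"
    by (simp add: A_def matrix_inv_mult_left[OF \<open>invertible U\<close>] flip: matrix_mul_assoc)
  have graph: "null_v w = A *v null_u w" if "w \<in> P" for w
    using P_comb[OF that] by (auto simp: u_comb v_comb matrix_vector_mul_assoc AU)
  have lift: "null_point u (A *v u) \<in> P" for u
  proof -
    have "U ** matrix_inv U = mat 1"
      using matrix_inv_mult_left[OF \<open>invertible U\<close>] matrix_left_right_inverse by blast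
    then have "null_u (comb (matrix_inv U *v u)) = u" by (simp add: u_comb matrix_vector_mul_assoc)
    then show ?thesis using comb_P[of "matrix_inv U *v u"] graph by (metis null_point_coords)
  qed
  then have P_eq: "P = null_graph A"
    using graph null_graph_eq_range[of A] by (auto simp: null_graph_def)
  have "transpose A = A"
  proof -
    have "A $ i $ j = A $ j $ i" for i j
    proof -
      have "A *v axis k 1 = column k A" for k
        by (simp add: matrix_vector_mult_basis)
      then show ?thesis
        using omega_null[of "null_point (axis i 1) (A *v axis i 1)" "null_point (axis j 1) (A *v axis j 1)"]
          lag[OF lift[of "axis i 1"] lift[of "axis j 1"]] by (simp add: inner_axis' column_def)
    qed
    then show ?thesis by (simp add: vec_eq_iff transpose_def)
  qed
  moreover have "x \<bullet> (A *v x) > 0" if "x \<noteq> 0" for x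
  proof -
    have "null_point x (A *v x) \<noteq> 0"
      using that null_coords(1)[of x "A *v x"] linear_0[OF linear_null_u] by metis
    then show ?thesis using pos lift[of x] split_inner_null[of "null_point x (A *v x)"]
      unfolding spacelike_def by (metis null_coords)
  qed
  ultimately have "posdef A" by (simp add: posdef_def)
  moreover have "det A = 1"
  proof -
    have "range b \<subseteq> P" using span span_superset[of "range b"] by simp
    from im[OF this] have "det U = det V" using dIm_dz_null[of b] by (simp add: U_def V_def)
    moreover have "det V = det A * det U" by (simp add: det_mul flip: AU)
    moreover have "det U \<noteq> 0" using \<open>invertible U\<close> invertible_det_nz by blast
    ultimately show ?thesis by simp
  qed
  ultimately show ?thesis using that P_eq by blast
qed

lemma dim_null_graph: "dim (null_graph (A :: real^'n^'n)) = CARD('n::finite)"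
  using dim_image_eq[OF linear_null_graph, of A UNIV] inj_null_graph[of A]
  by (simp add: null_graph_eq_range)

lemma tangent_space_null_graph:
  assumes "p \<in> null_graph A"
  shows "tangent_space (null_graph A) p = null_graph A"
proof
  show "null_graph A \<subseteq> tangent_space (null_graph A) p"
  proof
    fix v assume "v \<in> null_graph A"
    then have "p + t *\<^sub>R v \<in> null_graph A" for t
      using assms subspace_null_graph[of A] by (simp add: subspace_add subspace_scale)
    moreover have "((\<lambda>t. p + t *\<^sub>R v) has_vector_derivative v) (at 0)"
      by (auto intro!: derivative_eq_intros)
    ultimately show "v \<in> tangent_space (null_graph A) p"
      unfolding tangent_space_def by (force intro!: exI[of _ "\<lambda>t. p + t *\<^sub>R v"] exI[of _ "1::real"])
  qed
  show "tangent_space (null_graph A) p \<subseteq> null_graph A"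
  proof
    fix v assume "v \<in> tangent_space (null_graph A) p"
    then obtain \<gamma> e where \<gamma>: "e > 0" "\<And>t::real. \<bar>t\<bar> < e \<Longrightarrow> \<gamma> t \<in> null_graph A"
      "(\<gamma> has_vector_derivative v) (at 0)" by (auto simp: tangent_space_def)
    \<comment> \<open>The linear defect whose kernel is the graph: it vanishes along the curve,
      hence on the velocity.\<close>
    define l where "l w = null_v w - A *v null_u w" for w
    have "bounded_linear l" unfolding l_def
      by (intro bounded_linear_sub bounded_linear_null_v
          bounded_linear_compose[OF matrix_vector_mul_bounded_linear bounded_linear_null_u])
    from bounded_linear.has_vector_derivative[OF this \<gamma>(3)]
    have "((\<lambda>t. l (\<gamma> t)) has_vector_derivative l v) (at 0)" .
    moreover have "((\<lambda>t. l (\<gamma> t)) has_vector_derivative 0) (at 0)"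
    proof (rule has_vector_derivative_transform_within_open[OF has_vector_derivative_const])
      show "open (ball (0::real) e)" "0 \<in> ball (0::real) e" using \<gamma>(1) by auto
      show "\<And>t. t \<in> ball 0 e \<Longrightarrow> 0 = l (\<gamma> t)"
        using \<gamma>(2) by (simp add: l_def null_graph_def dist_real_def)
    qed
    ultimately have "l v = 0" by (rule vector_derivative_unique_at)
    then show "v \<in> null_graph A" by (simp add: l_def null_graph_def)
  qed
qed

text \<open>The converse of \<open>plane_eq_null_graph\<close>, with the constant orientation given
  by the image of the standard basis under the graph map.\<close>

lemma split_SLAG_plane_null_graph:
  fixes A :: "real^'n^'n"
  assumes A: "posdef A" "det A = 1"
  shows "split_SLAG_plane (null_graph A)"
proof -
  define L where "L u = null_point u (A *v u)" for u
  define b where "b j = L (axis j 1)" for j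
  define Or where "Or = {c. same_orientation b c}"
  have tA: "transpose A = A" using A(1) by (simp add: posdef_def)
  have linL: "linear L" and injL: "inj L" and rangeL: "range L = null_graph A"
    unfolding L_def[abs_def] using linear_null_graph[of A] inj_null_graph[of A] null_graph_eq_range[of A] by auto
  have blL: "bounded_linear L" using linL linear_conv_bounded_linear by blast
  have range_axis: "range (\<lambda>j. axis j (1::real) :: real^'n) = Basis"
    by (auto simp: Basis_vec_def)
  have range_b: "range b = L ` Basis" unfolding b_def[abs_def] range_axis[symmetric] by auto
  have frame: "frame_of (null_graph A) b"
    unfolding frame_of_def
  proof (intro conjI)
    show "inj b" unfolding b_def[abs_def] by (intro injI) (auto dest!: injD[OF injL] simp: axis_eq_axis)
    show "independent (range b)" unfolding range_b
      using linear_independent_injective_image[OF linL independent_Basis] injL by (simp add: span_Basis)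
    show "span (range b) = null_graph A" unfolding range_b
      using linear_span_image[OF linL, of Basis] by (simp add: span_Basis rangeL)
  qed
  have "same_orientation b b"
    unfolding same_orientation_def
  proof (intro exI conjI allI)
    show "det (mat 1 :: real^'n^'n) > 0" by simp
    show "b j = (\<Sum>i\<in>UNIV. mat 1 $ i $ j *\<^sub>R b i)" for j
      by (simp add: mat_def if_distrib[of "\<lambda>x. x *\<^sub>R _"] cong: if_cong)
  qed
  then have bOr: "b \<in> Or" by (simp add: Or_def)
  have param: "local_C1_parametrization (null_graph A) UNIV L (\<lambda>_. Blinfun L)"
    unfolding local_C1_parametrization_def
  proof (intro conjI ballI)
    show "\<exists>g. homeomorphism UNIV (range L) L g"
    proof (intro exI homeomorphismI)
      show "continuous_on UNIV L" "continuous_on (range L) null_u"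
        by (simp_all add: linear_continuous_on blL bounded_linear_null_u)
    qed (auto simp: L_def)
    show "(L has_derivative blinfun_apply (Blinfun L)) (at u)" for u
      using blL by (simp add: bounded_linear_Blinfun_apply bounded_linear_imp_has_derivative)
    show "inj (blinfun_apply (Blinfun L))" using injL blL by (simp add: bounded_linear_Blinfun_apply)
  qed (auto simp: rangeL)
  \<comment> \<open>The first component of \<open>null_point u (A *v u)\<close> is
    \<open>H *v u\<close>, so \<open>H\<close> is the matrix of the projection to the real part, and
    its positive determinant makes the orientation positive.\<close>
  define H where "H = (1/2) *\<^sub>R (mat 1 + A)"
  have "posdef H"
  proof -
    have "transpose H = H" using tA by (simp add: H_def transpose_def vec_eq_iff mat_def)
    moreover have "x \<bullet> (H *v x) > 0" if "x \<noteq> 0" for x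
      using A(1) that by (simp add: H_def posdef_def matrix_vector_mult_add_rdistrib inner_add_right add_pos_pos
          flip: scaleR_matrix_vector_assoc)
    ultimately show ?thesis by (simp add: posdef_def)
  qed
  have fst_b: "fst (b j) $ i = H $ i $ j" for i j
    unfolding b_def L_def null_point_def H_def matrix_vector_mult_basis
    by (simp add: column_def mat_def axis_def)
  have "det (\<chi> i j. fst (c j) $ i) > 0" if c: "c \<in> Or" for c
  proof -
    obtain Q :: "real^'n^'n" where Q: "det Q > 0" "\<And>j. c j = (\<Sum>i\<in>UNIV. Q $ i $ j *\<^sub>R b i)"
      using c unfolding Or_def same_orientation_def by blast
    have "(\<chi> i j. fst (c j) $ i) = H ** Q"
      by (simp add: vec_eq_iff Q(2) fst_sum matrix_matrix_mult_def fst_b mult.commute)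
    then show ?thesis using Q(1) posdef_det_pos[OF \<open>posdef H\<close>] by (simp add: det_mul)
  qed
  moreover have "spacelike (null_graph A)"
    unfolding spacelike_def
  proof (intro ballI impI)
    fix v assume v: "v \<in> null_graph A" "v \<noteq> 0"
    then have "null_u v \<noteq> 0"
      using null_eqI[of v 0] by (auto simp: null_graph_def linear_0[OF linear_null_u] linear_0[OF linear_null_v])
    then show "split_inner v v > 0" using v(1) A(1) by (simp add: split_inner_null null_graph_def posdef_def)
  qed
  ultimately have "positive_plane (null_graph A) Or" by (simp add: positive_plane_def)
  moreover have "omega v w = 0" if "v \<in> null_graph A" "w \<in> null_graph A" for v w
    using that omega_null[of v w] inner_symmetric_matrix[OF tA, of "null_u v" "null_u w"]
    by (simp add: null_graph_def)
  moreover have "dIm (dz v) = 0" if "range v \<subseteq> null_graph A" for v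
  proof -
    have "null_v (v j) = A *v null_u (v j)" for j using that by (auto simp: null_graph_def)
    then have "(\<chi> i j. null_v (v j) $ i) = A ** (\<chi> i j. null_u (v j) $ i)"
      by (simp add: vec_eq_iff matrix_matrix_mult_def matrix_vector_mult_def)
    then show ?thesis using dIm_dz_null[of v] A(2) by (simp add: det_mul)
  qed
  moreover have "oriented_C1_submanifold (null_graph A) (\<lambda>_. Or)"
    unfolding oriented_C1_submanifold_def
  proof (intro conjI ballI)
    fix p assume p: "p \<in> null_graph A"
    show "orientation_of (tangent_space (null_graph A) p) Or"
      unfolding tangent_space_null_graph[OF p] orientation_of_def using frame Or_def by blast
    have "(\<lambda>j. blinfun_apply (Blinfun L) (axis j 1)) \<in> Or"
      using bOr blL by (simp add: bounded_linear_Blinfun_apply b_def[abs_def])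
    then show "\<exists>W f f'. local_C1_parametrization (null_graph A) W f f' \<and> p \<in> f ` W \<and>
        (\<forall>u\<in>W. (\<lambda>j. blinfun_apply (f' u) (axis j 1)) \<in> Or)"
      using param p rangeL by blast
  qed
  ultimately have "split_SLAG_submanifold UNIV (null_graph A) (\<lambda>_. Or)"
    unfolding split_SLAG_submanifold_def
    using closed_subspace[OF subspace_null_graph, of A] by (auto simp: tangent_space_null_graph)
  then show ?thesis
    unfolding split_SLAG_plane_def using subspace_null_graph[of A] dim_null_graph[of A] by blast
qed

section \<open>Charts of split SLAG submanifolds\<close>

lemma derivative_in_tangent_space:
  fixes f :: "'b::real_normed_vector \<Rightarrow> 'a::real_normed_vector"
  assumes "open W" "w \<in> W" "f ` W \<subseteq> M" and f: "(f has_derivative D) (at w)"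
  shows "D \<xi> \<in> tangent_space M (f w)"
proof -
  obtain d where d: "d > 0" "\<And>t. \<bar>t\<bar> < d \<Longrightarrow> w + t *\<^sub>R \<xi> \<in> W"
    using open_contains_short_segment[OF assms(1,2)] by blast
  have "((\<lambda>t. f (w + t *\<^sub>R \<xi>)) has_vector_derivative D \<xi>) (at 0)"
    by (rule has_vector_derivative_along_line) (simp add: f)
  then show ?thesis
    unfolding tangent_space_def using d assms(3)
    by (intro CollectI exI[of _ "\<lambda>t. f (w + t *\<^sub>R \<xi>)"] exI[of _ d]) auto
qed

lemma tangent_space_scale:
  assumes "v \<in> tangent_space M p" and "\<And>z. z \<in> M \<Longrightarrow> t *\<^sub>R z \<in> M"
  shows "t *\<^sub>R v \<in> tangent_space M (t *\<^sub>R p)"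
proof -
  obtain \<gamma> e where \<gamma>: "e > 0" "\<gamma> 0 = p" "\<And>s::real. \<bar>s\<bar> < e \<Longrightarrow> \<gamma> s \<in> M"
    "(\<gamma> has_vector_derivative v) (at 0)" using assms(1) by (auto simp: tangent_space_def)
  have "((\<lambda>s. t *\<^sub>R \<gamma> s) has_vector_derivative t *\<^sub>R v) (at 0)"
    by (rule bounded_linear.has_vector_derivative[OF bounded_linear_scaleR_right \<gamma>(4)])
  then show ?thesis
    unfolding tangent_space_def using \<gamma> assms(2)
    by (intro CollectI exI[of _ "\<lambda>s. t *\<^sub>R \<gamma> s"] exI[of _ e]) auto
qed

text \<open>The ray through \<open>p\<close> has velocity \<open>p\<close>; in graph form this
  becomes Euler's relation \<open>field_apply_point\<close>.\<close>

lemma cone_point_in_tangent_space: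
  assumes "p \<in> M" and cone: "\<And>t z. t > 0 \<Longrightarrow> z \<in> M \<Longrightarrow> t *\<^sub>R z \<in> M"
  shows "p \<in> tangent_space M p"
proof -
  have "((\<lambda>s. (1 + s) *\<^sub>R p) has_vector_derivative p) (at 0)"
    by (auto intro!: derivative_eq_intros)
  then show ?thesis
    unfolding tangent_space_def using cone[OF _ assms(1)]
    by (intro CollectI exI[of _ "\<lambda>s. (1 + s) *\<^sub>R p"] exI[of _ 1]) auto
qed

text \<open>Tangent planes are recorded by a matrix field instead of oriented frames. Its continuity
  is not assumed but derived from the parametrizations, in
  \<open>continuous_on_field\<close>.\<close>

locale SLAG_tangent_field =
  fixes M :: "'n::finite dspace set" and A :: "'n dspace \<Rightarrow> real^'n^'n"
  assumes tangent: "p \<in> M \<Longrightarrow> tangent_space M p = null_graph (A p)"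
    and posdef_field: "p \<in> M \<Longrightarrow> posdef (A p)"
    and det_field: "p \<in> M \<Longrightarrow> det (A p) = 1"
    and parametrization: "p \<in> M \<Longrightarrow> \<exists>W f f'. local_C1_parametrization M W f f' \<and> p \<in> f ` W"
begin

text \<open>Tangent planes are graphs over the \<open>u\<close> coordinate, so \<open>null_u\<close>
  composed with a parametrization has invertible derivative, and the inverse function theorem
  expresses the \<open>v\<close> coordinate through \<open>u\<close>. The set \<open>N\<close>
  isolates the sheet of \<open>M\<close> through \<open>p\<close>; it exists because the
  parametrization is a homeomorphism onto a relatively open set.\<close>

lemma local_graph:
  assumes "p \<in> M"
  obtains r F N where "r > 0" "open N" "p \<in> N"
    "\<And>z. z \<in> M \<Longrightarrow> z \<in> N \<Longrightarrow> null_u z \<in> ball (null_u p) r \<and> null_v z = F (null_u z)"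
    "\<And>u. u \<in> ball (null_u p) r \<Longrightarrow> null_point u (F u) \<in> M"
    "\<And>u. u \<in> ball (null_u p) r \<Longrightarrow> (F has_derivative (*v) (A (null_point u (F u)))) (at u)"
    "continuous_on (ball (null_u p) r) (\<lambda>u. A (null_point u (F u)))"
proof -
  obtain W f f' w0 where par: "local_C1_parametrization M W f f'" and w0: "w0 \<in> W" "p = f w0"
    using parametrization[OF assms] by blast
  have W: "open W" and fopen: "openin (top_of_set M) (f ` W)"
    and df: "\<And>w. w \<in> W \<Longrightarrow> (f has_derivative blinfun_apply (f' w)) (at w)"
    and contf': "continuous_on W f'" and injf': "\<And>w. w \<in> W \<Longrightarrow> inj (blinfun_apply (f' w))"
    using par unfolding local_C1_parametrization_def by auto
  obtain f1 where hom: "homeomorphism W (f ` W) f f1"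
    using par unfolding local_C1_parametrization_def by blast
  have fM: "f ` W \<subseteq> M" using openin_imp_subset[OF fopen] .
  define h where "h w = null_u (f w)" for w
  define h' where "h' w = Blinfun null_u o\<^sub>L f' w" for w
  have h'_apply: "blinfun_apply (h' w) \<xi> = null_u (f' w \<xi>)" for w \<xi>
    by (simp add: h'_def bounded_linear_Blinfun_apply bounded_linear_null_u)
  have dh: "(h has_derivative blinfun_apply (h' w)) (at w)" if "w \<in> W" for w
    using bounded_linear.has_derivative[OF bounded_linear_null_u df[OF that]]
    unfolding h_def[abs_def] by (simp add: h'_apply[abs_def])
  have conth': "continuous_on W h'" unfolding h'_def by (intro continuous_intros contf')
  have tang: "null_v (f' w \<xi>) = A (f w) *v null_u (f' w \<xi>)" if "w \<in> W" for w \<xi>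
    using derivative_in_tangent_space[OF W that fM df[OF that], of \<xi>] tangent[of "f w"] that fM
    by (auto simp: null_graph_def)
  define Uw :: "real^'n \<Rightarrow> real^'n^'n" where "Uw w = matrix (blinfun_apply (h' w))" for w
  define Vw :: "real^'n \<Rightarrow> real^'n^'n" where "Vw w = matrix (\<lambda>\<xi>. null_v (f' w \<xi>))" for w
  have Uw: "Uw w *v \<xi> = h' w \<xi>" for w \<xi>
    unfolding Uw_def by (simp add: matrix_works bounded_linear.linear[OF blinfun.bounded_linear_right])
  have Vw: "Vw w *v \<xi> = null_v (f' w \<xi>)" for w \<xi>
  proof -
    have "linear (\<lambda>\<xi>. null_v (f' w \<xi>))"
      by (intro bounded_linear.linear bounded_linear_compose[OF bounded_linear_null_v blinfun.bounded_linear_right])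
    then show ?thesis unfolding Vw_def by (simp add: matrix_works)
  qed
  have invertible: "invertible (Uw w)" if "w \<in> W" for w
  proof -
    have "\<xi> = 0" if "Uw w *v \<xi> = 0" for \<xi>
    proof -
      have "null_u (f' w \<xi>) = 0" using that by (simp add: Uw h'_apply)
      then have "f' w \<xi> = 0" using tang[OF \<open>w \<in> W\<close>, of \<xi>]
        by (intro null_eqI) (simp_all add: linear_0[OF linear_null_u] linear_0[OF linear_null_v])
      then show "\<xi> = 0" using injf'[OF \<open>w \<in> W\<close>] by (metis blinfun.zero_right injD)
    qed
    then show ?thesis by (metis invertible_left_inverse matrix_left_invertible_ker)
  qed
  \<comment> \<open>\<open>Uw\<close> and \<open>Vw\<close> are the two null components of the
    differential. Both are continuous in \<open>w\<close>, and this formula passes their continuity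
    on to \<open>A\<close>.\<close>
  have AUV: "A (f w) = Vw w ** matrix_inv (Uw w)" if "w \<in> W" for w
  proof -
    have "A (f w) ** Uw w = Vw w"
      by (simp add: matrix_eq Uw Vw h'_apply tang[OF that] flip: matrix_vector_mul_assoc)
    moreover have "Uw w ** matrix_inv (Uw w) = mat 1"
      using matrix_inv_mult_left[OF invertible[OF that]] matrix_left_right_inverse by blast
    ultimately show ?thesis by (metis matrix_mul_assoc matrix_mul_rid)
  qed
  have contA: "continuous_on W (\<lambda>w. A (f w))"
  proof -
    have U: "continuous_on W Uw" unfolding Uw_def matrix_def
      by (intro continuous_on_vec_lambda continuous_intros conth')
    have "continuous_on W (\<lambda>w. null_v (f' w \<xi>))" for \<xi>
      by (intro linear_continuous_on_compose[OF _ linear_null_v] continuous_intros contf')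
    then have V: "continuous_on W Vw" unfolding Vw_def matrix_def
      by (intro continuous_on_vec_lambda continuous_on_component)
    have "continuous_on W (\<lambda>w. matrix_inv (Uw w))"
      using invertible by (intro continuous_on_matrix_inv U) (simp add: invertible_det_nz)
    then have "continuous_on W (\<lambda>w. Vw w ** matrix_inv (Uw w))" unfolding matrix_matrix_mult_def
      by (intro continuous_on_vec_lambda continuous_intros continuous_on_component V)
    then show ?thesis using AUV by (simp cong: continuous_on_cong)
  qed
  have "Blinfun ((*v) (matrix_inv (Uw w0))) o\<^sub>L h' w0 = id_blinfun"
    by (rule blinfun_eqI)
      (simp add: bounded_linear_Blinfun_apply matrix_vector_mul_assoc matrix_inv_mult_left[OF invertible[OF w0(1)]]
        flip: Uw)
  from inverse_function_theorem[OF W dh conth' w0(1) this]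
  obtain U' V' g g' where ift: "open U'" "U' \<subseteq> W" "w0 \<in> U'" "open V'" "h w0 \<in> V'" "homeomorphism U' V' h g"
    "\<And>y. y \<in> V' \<Longrightarrow> (g has_derivative (g' y)) (at y)"
    "\<And>y. y \<in> V' \<Longrightarrow> g' y = inv (blinfun_apply (h'(g y)))"
    "\<And>y. y \<in> V' \<Longrightarrow> bij (blinfun_apply (h'(g y)))" by blast
  have gW: "g u \<in> U'" "g u \<in> W" "h (g u) = u" if "u \<in> V'" for u
    using ift(2,6) that by (auto simp: homeomorphism_def)
  define F where "F u = null_v (f (g u))" for u
  have point: "null_point u (F u) = f (g u)" if "u \<in> V'" for u
    using gW(3)[OF that] by (intro null_eqI) (simp_all add: F_def h_def)
  obtain r where r: "r > 0" "ball (null_u p) r \<subseteq> V'"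
    using ift(4,5) w0(2) open_contains_ball unfolding h_def by blast
  have "openin (top_of_set (f ` W)) (f ` U')"
    using homeomorphism_imp_open_map[OF hom] ift(1,2) by (simp add: openin_open_eq W)
  then have "openin (top_of_set M) (f ` U')" using openin_trans fopen by blast
  then obtain N' where N': "open N'" "f ` U' = M \<inter> N'" by (auto simp: openin_open)
  define N where "N = N' \<inter> null_u -` ball (null_u p) r"
  show ?thesis
  proof (rule that[OF r(1), of N F])
    show "open N" unfolding N_def
      by (intro open_Int N'(1) open_vimage open_ball linear_continuous_on bounded_linear_null_u)
    show "p \<in> N" using N'(2) ift(3) w0(2) r(1) by (auto simp: N_def)
    show "null_u z \<in> ball (null_u p) r \<and> null_v z = F (null_u z)" if z: "z \<in> M" "z \<in> N" for z
    proof -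
      obtain w where w: "w \<in> U'" "z = f w" using z N'(2) by (auto simp: N_def)
      have "g (null_u z) = w" using ift(6) w by (auto simp: homeomorphism_def h_def)
      then show ?thesis using z(2) w(2) by (auto simp: F_def N_def)
    qed
    show "null_point u (F u) \<in> M" if "u \<in> ball (null_u p) r" for u
    proof -
      have u: "u \<in> V'" using that r(2) by blast
      then show ?thesis unfolding point[OF u] using gW(2)[OF u] fM by blast
    qed
    show "(F has_derivative (*v) (A (null_point u (F u)))) (at u)" if "u \<in> ball (null_u p) r" for u
    proof -
      have u: "u \<in> V'" using that r(2) by blast
      have "((\<lambda>u. f (g u)) has_derivative (\<lambda>\<xi>. f' (g u) (g' u \<xi>))) (at u)"
        by (rule has_derivative_compose[OF ift(7)[OF u] df[OF gW(2)[OF u]]])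
      from bounded_linear.has_derivative[OF bounded_linear_null_v this]
      have "(F has_derivative (\<lambda>\<xi>. null_v (f' (g u) (g' u \<xi>)))) (at u)" by (simp add: F_def[abs_def])
      moreover have "null_v (f' (g u) (g' u \<xi>)) = A (null_point u (F u)) *v \<xi>" for \<xi>
      proof -
        have "h' (g u) (g' u \<xi>) = \<xi>"
          using ift(8,9)[OF u] by (simp add: bij_is_surj surj_f_inv_f)
        then show ?thesis using tang[OF gW(2)[OF u]] by (simp add: point[OF u] h'_apply)
      qed
      ultimately show ?thesis by simp
    qed
    have "continuous_on V' g" using ift(6) by (simp add: homeomorphism_def)
    then have "continuous_on V' (\<lambda>u. A (f (g u)))"
      using continuous_on_compose2[OF contA] gW(2) by blast
    then have "continuous_on V' (\<lambda>u. A (null_point u (F u)))" by (rule continuous_on_eq) (simp add: point)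
    then show "continuous_on (ball (null_u p) r) (\<lambda>u. A (null_point u (F u)))"
      using r(2) continuous_on_subset by blast
  qed
qed

text \<open>Near \<open>p\<close> a point of \<open>M\<close> is recovered from its \<open>u\<close>
  coordinate, so \<open>A\<close> is the continuous chart expression composed with
  \<open>null_u\<close>.\<close>

lemma continuous_on_field: "continuous_on M A"
  unfolding continuous_on_eq_continuous_within
proof
  fix p assume p: "p \<in> M"
  obtain r F N where rFN: "r > 0" "open N" "p \<in> N"
    "\<And>z. z \<in> M \<Longrightarrow> z \<in> N \<Longrightarrow> null_u z \<in> ball (null_u p) r \<and> null_v z = F (null_u z)"
    "\<And>u. u \<in> ball (null_u p) r \<Longrightarrow> null_point u (F u) \<in> M"
    "\<And>u. u \<in> ball (null_u p) r \<Longrightarrow> (F has_derivative (*v) (A (null_point u (F u)))) (at u)"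
    "continuous_on (ball (null_u p) r) (\<lambda>u. A (null_point u (F u)))"
    by (rule local_graph[OF p]) blast
  have eq: "A z = A (null_point (null_u z) (F (null_u z)))" if "z \<in> M \<inter> N" for z
    using rFN(4)[of z] that by (metis IntE null_point_coords)
  have "continuous_on (M \<inter> N) (\<lambda>z. A (null_point (null_u z) (F (null_u z))))"
    by (rule continuous_on_compose2[OF rFN(7)])
      (use rFN(4) in \<open>auto intro: linear_continuous_on bounded_linear_null_u\<close>)
  then have "continuous_on (M \<inter> N) A" by (rule continuous_on_eq) (rule eq[symmetric])
  then have "continuous (at p within M \<inter> N) A"
    using p rFN(3) by (simp add: continuous_on_eq_continuous_within)
  then show "continuous (at p within M) A"
    using at_within_nhd[of p N M "M \<inter> N"] rFN(2,3) by (simp add: continuous_within Int_ac)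
qed

end

section \<open>Cones\<close>

text \<open>\<open>M\<close> is the cone without its vertex; the compact link lets functions
  homogeneous of degree 0 attain their maximum.\<close>

locale SLAG_cone = SLAG_tangent_field M A
  for M :: "'n::finite dspace set" and A +
  assumes cone: "t > 0 \<Longrightarrow> z \<in> M \<Longrightarrow> t *\<^sub>R z \<in> M"
    and zero_notin: "0 \<notin> M"
    and compact_link: "compact (M \<inter> sphere 0 1)"
    and nonempty: "M \<noteq> {}"
    and connected_cone: "connected M"
begin

lemma field_apply_point:
  assumes "p \<in> M"
  shows "null_v p = A p *v null_u p"
  using cone_point_in_tangent_space[OF assms cone] tangent[OF assms] by (simp add: null_graph_def)

text \<open>Scaling maps \<open>M\<close> into itself and fixes every linear plane, so the tangent
  planes at \<open>p\<close> and \<open>t *\<^sub>R p\<close> agree. One inclusion is enough, since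
  a graph determines its matrix.\<close>

lemma field_scale:
  assumes "t > 0" "p \<in> M"
  shows "A (t *\<^sub>R p) = A p"
proof -
  have sub: "null_graph (A p) \<subseteq> null_graph (A (t *\<^sub>R p))"
  proof
    fix w assume "w \<in> null_graph (A p)"
    then have "(1 / t) *\<^sub>R w \<in> tangent_space M p"
      unfolding tangent[OF assms(2)] by (rule subspace_scale[OF subspace_null_graph])
    from tangent_space_scale[OF this cone[OF assms(1)]] show "w \<in> null_graph (A (t *\<^sub>R p))"
      using assms by (simp add: tangent[OF cone[OF assms]])
  qed
  have "A (t *\<^sub>R p) *v u = A p *v u" for u
  proof -
    have "null_point u (A p *v u) \<in> null_graph (A p)" by (simp add: null_graph_def)
    with sub have "null_point u (A p *v u) \<in> null_graph (A (t *\<^sub>R p))" by blast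
    then show ?thesis by (simp add: null_graph_def)
  qed
  then show ?thesis by (simp add: matrix_eq)
qed

text \<open>Over a chart the cone is the graph of the gradient of \<open>u \<bullet> F u / 2\<close>: the derivative of \<open>F\<close>
  is symmetric, and Euler's relation \<open>F u = DF(u) u\<close> expresses homogeneity.\<close>

lemma second_derivative_locally_constant_at_max:
  assumes p: "p \<in> M" and max: "\<And>z. z \<in> M \<Longrightarrow> e \<bullet> (A z *v e) \<le> e \<bullet> (A p *v e)"
  shows "\<exists>N. open N \<and> p \<in> N \<and> (\<forall>z\<in>M \<inter> N. e \<bullet> (A z *v e) = e \<bullet> (A p *v e))"
proof -
  obtain r F N where r: "r > 0" and N: "open N" "p \<in> N"
    "\<And>z. z \<in> M \<Longrightarrow> z \<in> N \<Longrightarrow> null_u z \<in> ball (null_u p) r \<and> null_v z = F (null_u z)"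
    and FM: "\<And>u. u \<in> ball (null_u p) r \<Longrightarrow> null_point u (F u) \<in> M"
    and dF: "\<And>u. u \<in> ball (null_u p) r \<Longrightarrow> (F has_derivative (*v) (A (null_point u (F u)))) (at u)"
    and cont: "continuous_on (ball (null_u p) r) (\<lambda>u. A (null_point u (F u)))"
    by (rule local_graph[OF p]) blast
  interpret unimodular_hessian "ball (null_u p) r" "\<lambda>u. (u \<bullet> F u) / 2" F "\<lambda>u. A (null_point u (F u))"
  proof
    fix u assume u: "u \<in> ball (null_u p) r"
    let ?A = "A (null_point u (F u))"
    show "posdef ?A" "det ?A = 1" using posdef_field det_field FM[OF u] by auto
    have sym: "transpose ?A = ?A" using posdef_field[OF FM[OF u]] by (simp add: posdef_def)
    have Fu: "F u = ?A *v u" using field_apply_point[OF FM[OF u]] by simp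
    have "((\<lambda>u. u \<bullet> F u) has_derivative (\<lambda>\<xi>. u \<bullet> (?A *v \<xi>) + \<xi> \<bullet> F u)) (at u)"
      by (rule has_derivative_inner[OF has_derivative_ident dF[OF u]])
    moreover have "u \<bullet> (?A *v \<xi>) = F u \<bullet> \<xi>" for \<xi>
      using inner_symmetric_matrix[OF sym, of u \<xi>] Fu by (simp add: inner_commute)
    ultimately have "((\<lambda>u. u \<bullet> F u) has_derivative (\<lambda>\<xi>. 2 * (F u \<bullet> \<xi>))) (at u)"
      by (simp add: inner_commute)
    from has_derivative_mult_right[OF this, of "1/2"]
    show "((\<lambda>u. (u \<bullet> F u) / 2) has_derivative (\<lambda>\<xi>. F u \<bullet> \<xi>)) (at u)" by simp
  qed (use dF cont in auto)
  have pF: "null_point (null_u z) (F (null_u z)) = z" if "z \<in> M \<inter> N" for z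
    using N(3)[of z] that by (metis IntE null_point_coords)
  \<comment> \<open>The radius \<open>r / 4\<close> is the one granted by
    \<open>local_strong_maximum_principle\<close>.\<close>
  define N' where "N' = N \<inter> null_u -` ball (null_u p) (r / 4)"
  have "open N'" unfolding N'_def
    by (intro open_Int N(1) open_vimage open_ball linear_continuous_on bounded_linear_null_u)
  moreover have "p \<in> N'" using N(2) r by (simp add: N'_def)
  moreover have "e \<bullet> (A z *v e) = e \<bullet> (A p *v e)" if z: "z \<in> M \<inter> N'" for z
  proof -
    have "e \<bullet> (A (null_point (null_u z) (F (null_u z))) *v e) =
        e \<bullet> (A (null_point (null_u p) (F (null_u p))) *v e)"
    proof (rule local_strong_maximum_principle[OF r order_refl])
      show "null_u z \<in> ball (null_u p) (r / 4)" using z by (simp add: N'_def)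
      show "e \<bullet> (A (null_point x (F x)) *v e) \<le> e \<bullet> (A (null_point (null_u p) (F (null_u p))) *v e)"
        if "x \<in> ball (null_u p) r" for x
        using max[OF FM[OF that]] pF[of p] p N(2) by simp
    qed
    then show ?thesis using pF[of z] pF[of p] z p N(2) by (simp add: N'_def)
  qed
  ultimately show ?thesis by blast
qed

lemma second_derivative_constant:
  assumes "p \<in> M" "q \<in> M"
  shows "e \<bullet> (A p *v e) = e \<bullet> (A q *v e)"
proof -
  define g where "g z = e \<bullet> (A z *v e)" for z
  have cont: "continuous_on M g"
    unfolding g_def inner_vec_def matrix_vector_mult_def
    by (simp, intro continuous_intros continuous_on_field)
  have norm_link: "(1 / norm z) *\<^sub>R z \<in> M \<inter> sphere 0 1" "g z = g ((1 / norm z) *\<^sub>R z)" if "z \<in> M" for z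
  proof -
    have "z \<noteq> 0" using that zero_notin by blast
    then show "(1 / norm z) *\<^sub>R z \<in> M \<inter> sphere 0 1" using cone[of "1 / norm z" z] that by simp
    show "g z = g ((1 / norm z) *\<^sub>R z)" using field_scale[of "1 / norm z" z] that \<open>z \<noteq> 0\<close> by (simp add: g_def)
  qed
  then have "M \<inter> sphere 0 1 \<noteq> {}" using nonempty by blast
  then obtain m where m: "m \<in> M \<inter> sphere 0 1" "\<And>z. z \<in> M \<inter> sphere 0 1 \<Longrightarrow> g z \<le> g m"
    using continuous_attains_sup[OF compact_link _ continuous_on_subset[OF cont]] by blast
  have max: "g z \<le> g m" if "z \<in> M" for z
    using m(2)[OF norm_link(1)[OF that]] norm_link(2)[OF that] by simp
  \<comment> \<open>Every point of \<open>Z\<close> is again a global maximum, so the local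
    principle applies at each of them and makes \<open>Z\<close> open.\<close>
  define Z where "Z = {z \<in> M. g z = g m}"
  have "closedin (top_of_set M) Z"
    using continuous_closedin_preimage[OF cont closed_singleton[of "g m"]]
    by (simp add: Z_def vimage_def Int_def)
  moreover have "openin (top_of_set M) Z"
  proof (subst openin_subopen, intro ballI)
    fix z assume z: "z \<in> Z"
    then have "\<exists>N. open N \<and> z \<in> N \<and> (\<forall>y\<in>M \<inter> N. e \<bullet> (A y *v e) = e \<bullet> (A z *v e))"
      using max by (intro second_derivative_locally_constant_at_max) (auto simp: Z_def g_def)
    then obtain N where "open N" "z \<in> N" "\<And>y. y \<in> M \<inter> N \<Longrightarrow> g y = g z" unfolding g_def by blast
    then show "\<exists>T. openin (top_of_set M) T \<and> z \<in> T \<and> T \<subseteq> Z"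
      using z by (intro exI[of _ "M \<inter> N"]) (auto simp: Z_def openin_open_Int)
  qed
  moreover have "m \<in> Z" using m(1) by (simp add: Z_def)
  ultimately have "Z = M" using connected_cone unfolding connected_clopen by blast
  then have "p \<in> Z" "q \<in> Z" using assms by auto
  then show ?thesis by (simp add: Z_def g_def)
qed

lemma field_constant:
  assumes "p \<in> M" "q \<in> M"
  shows "A p = A q"
proof -
  have sym: "transpose (A z) = A z" if "z \<in> M" for z using posdef_field[OF that] by (simp add: posdef_def)
  have polar: "2 * (x \<bullet> (A z *v y)) = (x + y) \<bullet> (A z *v (x + y)) - x \<bullet> (A z *v x) - y \<bullet> (A z *v y)"
    if "z \<in> M" for x y z
    using inner_symmetric_matrix[OF sym[OF that], of x y]
    by (simp add: matrix_vector_right_distrib inner_add_left inner_add_right)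
  have "x \<bullet> (A p *v y) = x \<bullet> (A q *v y)" for x y
    using polar[OF assms(1), of x y] polar[OF assms(2), of x y]
      second_derivative_constant[OF assms, of "x + y"] second_derivative_constant[OF assms, of x]
      second_derivative_constant[OF assms, of y] by simp
  then have "A p *v y = A q *v y" for y by (metis vector_eq_rdot inner_commute)
  then show ?thesis by (simp add: matrix_eq)
qed

text \<open>Dimension at least 2 makes the punctured plane connected, so a nonempty subset that is
  open and closed in it is everything. In dimension 1 an open ray would be a counterexample.\<close>

lemma eq_punctured_null_graph:
  assumes "CARD('n) \<ge> 2" "p \<in> M" "closedin (top_of_set (UNIV - {0})) M"
  shows "M = null_graph (A p) - {0}"
proof -
  define P where "P = null_graph (A p)"
  define L where "L u = null_point u (A p *v u)" for u
  have sub: "M \<subseteq> P - {0}"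
    using zero_notin field_apply_point field_constant[OF _ assms(2)] by (auto simp: P_def null_graph_def)
  have "P - {0} = L ` (- {0})"
  proof -
    have "L 0 = 0" unfolding L_def by (rule linear_0[OF linear_null_graph])
    moreover have "inj L" unfolding L_def[abs_def] by (rule inj_null_graph)
    moreover have "P = range L" unfolding P_def L_def[abs_def] by (rule null_graph_eq_range)
    ultimately show ?thesis by (auto simp: inj_def)
  qed
  moreover have "connected (L ` (- {0}))"
  proof (rule connected_continuous_image)
    show "continuous_on (- {0}) L" unfolding L_def[abs_def]
      using linear_continuous_on linear_conv_bounded_linear linear_null_graph by blast
    show "connected (- {0::real^'n})" using assms(1) by (intro connected_punctured_universe) simp
  qed
  ultimately have "connected (P - {0})" by simp
  moreover have "closedin (top_of_set (P - {0})) M"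
    using closedin_subset_trans[OF assms(3) sub] by blast
  moreover have "openin (top_of_set (P - {0})) M"
  proof (subst openin_subopen, intro ballI)
    fix q assume q: "q \<in> M"
    obtain r F where r: "r > 0" and FM: "\<And>u. u \<in> ball (null_u q) r \<Longrightarrow> null_point u (F u) \<in> M"
      by (rule local_graph[OF q]) blast
    define T where "T = (P - {0}) \<inter> null_u -` ball (null_u q) r"
    have "z \<in> M" if z: "z \<in> T" for z
    proof -
      have u: "null_u z \<in> ball (null_u q) r" using z by (simp add: T_def)
      \<comment> \<open>The chart of \<open>M\<close> over the ball lies in the plane, and a point
        of the plane is determined by its \<open>u\<close> coordinate; so the part of the plane over
        the ball lies in \<open>M\<close>.\<close>
      have "F (null_u z) = A p *v null_u z"
        using FM[OF u] sub by (auto simp: P_def null_graph_def)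
      also have "\<dots> = null_v z" using z by (simp add: T_def P_def null_graph_def)
      finally show ?thesis using FM[OF u] by simp
    qed
    moreover have "q \<in> T" using q sub r by (auto simp: T_def)
    moreover have "openin (top_of_set (P - {0})) T" unfolding T_def
      by (intro openin_open_Int open_vimage open_ball linear_continuous_on bounded_linear_null_u)
    ultimately show "\<exists>T. openin (top_of_set (P - {0})) T \<and> q \<in> T \<and> T \<subseteq> M" by blast
  qed
  ultimately have "M = P - {0}" using nonempty unfolding connected_clopen by blast
  then show ?thesis by (simp add: P_def)
qed

end

section \<open>Passage from split SLAG cones to matrix fields, and the conclusion\<close>

lemma split_SLAG_tangent_plane:
  assumes "split_SLAG_submanifold U M Or" "p \<in> M"
  shows "\<exists>A. posdef A \<and> det A = 1 \<and> tangent_space M p = null_graph A"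
proof -
  obtain b where "frame_of (tangent_space M p) b"
    using assms unfolding split_SLAG_submanifold_def oriented_C1_submanifold_def orientation_of_def by blast
  then show ?thesis
    by (rule plane_eq_null_graph)
      (use assms in \<open>auto simp: split_SLAG_submanifold_def positive_plane_def\<close>)
qed

theorem corollary7p2:
  fixes C :: "'n::finite dspace set"
  assumes "CARD('n) \<ge> 2"
    and "closed C"
    and "\<And>t::real. t > 0 \<Longrightarrow> (\<lambda>z. t *\<^sub>R z) ` C = C"
    and "C - {0} \<noteq> {}"
    and "connected (C - {0})"
    and "\<exists>Or. split_SLAG_submanifold (UNIV - {0}) (C - {0}) Or"
  shows "split_SLAG_plane C"
proof -
  define M where "M = C - {0}"
  obtain Or where SLAG: "split_SLAG_submanifold (UNIV - {0}) M Or" using assms(6) M_def by blast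
  obtain A where A: "\<And>p. p \<in> M \<Longrightarrow> posdef (A p) \<and> det (A p) = 1 \<and> tangent_space M p = null_graph (A p)"
    using split_SLAG_tangent_plane[OF SLAG] by metis
  interpret SLAG_cone M A
  proof
    show "\<exists>W f f'. local_C1_parametrization M W f f' \<and> p \<in> f ` W" if "p \<in> M" for p
      using SLAG that unfolding split_SLAG_submanifold_def oriented_C1_submanifold_def by blast
    show "t *\<^sub>R z \<in> M" if "t > 0" "z \<in> M" for t z
      using assms(3)[OF that(1)] that by (auto simp: M_def)
    have "M \<inter> sphere 0 1 = C \<inter> sphere 0 1" by (auto simp: M_def)
    then show "compact (M \<inter> sphere 0 1)" using assms(2) by (simp add: closed_Int_compact)
  qed (use A assms(4,5) in \<open>auto simp: M_def\<close>)
  obtain p where p: "p \<in> M" using nonempty by blast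
  have "closedin (top_of_set (UNIV - {0})) M" using SLAG by (simp add: split_SLAG_submanifold_def)
  then have M_eq: "C - {0} = null_graph (A p) - {0}"
    using eq_punctured_null_graph[OF assms(1) p] by (simp add: M_def)
  \<comment> \<open>The vertex returns as the limit of positive multiples of \<open>p\<close>, by
    closedness of \<open>C\<close>.\<close>
  have "0 \<in> C"
  proof -
    have lim: "(\<lambda>n. (1 / real (Suc n)) *\<^sub>R p) \<longlonglongrightarrow> 0 *\<^sub>R p"
      by (intro tendsto_intros LIMSEQ_Suc[OF lim_1_over_n])
    have "(1 / real (Suc n)) *\<^sub>R p \<in> C" for n
      using cone[of "1 / real (Suc n)" p] p by (simp add: M_def)
    from closed_sequentially[OF assms(2) this lim] show ?thesis by simp
  qed
  moreover have "0 \<in> null_graph (A p)" by (rule subspace_0[OF subspace_null_graph])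
  ultimately have "C = null_graph (A p)" using M_eq by blast
  then show ?thesis using split_SLAG_plane_null_graph[of "A p"] A[OF p] by simp
qed

end
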